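(* There exists an absolute constant $c > 0$ such that, if $\mathbf{L}$ is chosen uniformly at random from the set $\mathcal{L}_n$ of order-$n$ Latin squares with symbol set $[n]$, then asymptotically almost surely (i.e. with probability tending to $1$ as $n \to \infty$) $\mathbf{L}$ contains no order-$m$ Latin subsquare for any integer $m$ with $c\sqrt{n\log n} \le m < n$.
   Context: $[n] = \{1,\dots,n\}$. An order-$n$ Latin square is an $n\times n$ array of $n$ symbols in which each row and each column contains each symbol exactly once; $\mathcal{L}_n$ is the set of those with symbol set $[n]$. For $m<n$, an order-$m$ subsquare of an order-$n$ Latin square is an $m\times m$ array induced by choosing a set of $m$ rows and a set of $m$ columns (not necessarily consecutive). The subsquare is Latin if it is itself a Latin square (on some set of $m$ symbols). *)

theory Defs
  imports "HOL-Probability.Probability"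
begin

text \<open>
  An array is a function on pairs (row, column). The predicate below says that the part of \<open>L\<close>
  with rows \<open>R\<close> and columns \<open>C\<close> is a Latin square on the symbol set \<open>S\<close>; it only depends on the
  values of \<open>L\<close> on \<open>R \<times> C\<close>, so it applies directly to subarrays. Its order is \<open>card S\<close>.
\<close>

definition latin_square :: "nat set \<Rightarrow> nat set \<Rightarrow> nat set \<Rightarrow> (nat \<times> nat \<Rightarrow> nat) \<Rightarrow> bool" where
  "latin_square R C S L \<longleftrightarrow>
     finite R \<and> finite C \<and> finite S \<and> card R = card S \<and> card C = card S \<and>
     (\<forall>i\<in>R. \<forall>j\<in>C. L (i, j) \<in> S) \<and>
     (\<forall>i\<in>R. \<forall>s\<in>S. \<exists>!j. j \<in> C \<and> L (i, j) = s) \<and>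
     (\<forall>j\<in>C. \<forall>s\<in>S. \<exists>!i. i \<in> R \<and> L (i, j) = s)"

text \<open>
  Arrays are taken extensional (\<open>undefined\<close> outside the index square), so that each Latin square
  corresponds to exactly one function and the uniform distribution below is the intended one.
\<close>

definition latin_squares :: "nat \<Rightarrow> (nat \<times> nat \<Rightarrow> nat) set" where
  "latin_squares n =
     {L \<in> ({1..n} \<times> {1..n}) \<rightarrow>\<^sub>E {1..n}. latin_square {1..n} {1..n} {1..n} L}"

definition has_latin_subsquare :: "nat \<Rightarrow> nat \<Rightarrow> (nat \<times> nat \<Rightarrow> nat) \<Rightarrow> bool" where
  "has_latin_subsquare n m L \<longleftrightarrow>
     (\<exists>R C S. R \<subseteq> {1..n} \<and> C \<subseteq> {1..n} \<and> card R = m \<and> card C = m \<and> card S = m \<and>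
        latin_square R C S L)"

text \<open>
  The distribution \<open>pmf_of_set\<close> is only meaningful for finite nonempty sets; the next two facts
  show that it is uniform on \<open>latin_squares n\<close> for every \<open>n\<close>.
\<close>

lemma finite_latin_squares: "finite (latin_squares n)"
  by (rule finite_subset[of _ "({1..n} \<times> {1..n}) \<rightarrow>\<^sub>E {1..n}"])
     (auto simp: latin_squares_def intro!: finite_PiE)

lemma cyclic_ex1:
  fixes n i s :: nat
  assumes "i \<in> {1..n}" "s \<in> {1..n}"
  shows "\<exists>!j. j \<in> {1..n} \<and> (i + j) mod n + 1 = s"
proof -
  have n: "n > 0" using assms by auto
  let ?f = "\<lambda>j. (i + j) mod n + 1"
  have inj: "inj_on ?f {1..n}"
  proof (rule inj_onI)
    fix x y assume xy: "x \<in> {1..n}" "y \<in> {1..n}" "?f x = ?f y"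
    have *: "a = b" if "a \<le> b" "a \<in> {1..n}" "b \<in> {1..n}" "?f a = ?f b" for a b
    proof -
      have "(i + b) mod n = (i + a) mod n" using that by simp
      then have "n dvd (i + b) - (i + a)"
        using mod_eq_dvd_iff_nat[of "i + a" "i + b" n] that by simp
      then have "n dvd b - a" by simp
      moreover have "b - a < n" using that n by auto
      ultimately show ?thesis using that(1) by (metis diff_is_0_eq dual_order.antisym nat_dvd_not_less neq0_conv)
    qed
    show "x = y" using *[of x y] *[of y x] xy by (metis nat_le_linear)
  qed
  have "?f ` {1..n} \<subseteq> {1..n}"
  proof
    fix y assume "y \<in> ?f ` {1..n}"
    then obtain j where "y = ?f j" by auto
    moreover have "(i + j) mod n < n" using n by simp
    ultimately show "y \<in> {1..n}" by simp
  qed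
  then have "?f ` {1..n} = {1..n}" using inj by (intro endo_inj_surj) auto
  then obtain j where j: "j \<in> {1..n}" "s = ?f j" using assms(2) by (metis (no_types, lifting) imageE)
  show ?thesis
  proof (rule ex1I[of _ j])
    show "j \<in> {1..n} \<and> ?f j = s" using j by blast
    show "k = j" if "k \<in> {1..n} \<and> ?f k = s" for k
      using inj_onD[OF inj, of k j] that j by metis
  qed
qed

lemma latin_squares_nonempty: "latin_squares n \<noteq> {}"
proof -
  define L where "L = restrict (\<lambda>(i, j). (i + j) mod n + 1) ({1..n} \<times> {1..n})"
  have L: "L (i, j) = (i + j) mod n + 1" if "i \<in> {1..n}" "j \<in> {1..n}" for i j
    using that by (simp add: L_def)
  have in_range: "L (i, j) \<in> {1..n}" if "i \<in> {1..n}" "j \<in> {1..n}" for i j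
  proof -
    have "(i + j) mod n < n" using that by (intro mod_less_divisor) auto
    then show ?thesis using L[OF that] by simp
  qed
  have L': "L (j, i) = (i + j) mod n + 1" if "i \<in> {1..n}" "j \<in> {1..n}" for i j
    using L[OF that(2,1)] by (simp add: add.commute)
  have row: "\<exists>!j. j \<in> {1..n} \<and> L (i, j) = s" if "i \<in> {1..n}" "s \<in> {1..n}" for i s
  proof -
    have "(j \<in> {1..n} \<and> L (i, j) = s) = (j \<in> {1..n} \<and> (i + j) mod n + 1 = s)" for j
      using L[OF that(1), of j] by (cases "j \<in> {1..n}") (simp_all only: simp_thms)
    then show ?thesis using cyclic_ex1[OF that] by (simp only:)
  qed
  have col: "\<exists>!i. i \<in> {1..n} \<and> L (i, j) = s" if "j \<in> {1..n}" "s \<in> {1..n}" for j s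
  proof -
    have "(i \<in> {1..n} \<and> L (i, j) = s) = (i \<in> {1..n} \<and> (j + i) mod n + 1 = s)" for i
      using L'[OF that(1), of i] by (cases "i \<in> {1..n}") (simp_all only: simp_thms)
    then show ?thesis using cyclic_ex1[OF that] by (simp only:)
  qed
  have "latin_square {1..n} {1..n} {1..n} L"
    unfolding latin_square_def
    by (intro conjI ballI row col in_range) (simp_all del: atLeastAtMost_iff)
  moreover have "L \<in> ({1..n} \<times> {1..n}) \<rightarrow>\<^sub>E {1..n}"
    proof (rule PiE_I)
    show "L p \<in> {1..n}" if "p \<in> {1..n} \<times> {1..n}" for p
      using that in_range[of "fst p" "snd p"] by (simp add: mem_Times_iff)
    show "L p = undefined" if "p \<notin> {1..n} \<times> {1..n}" for p
      unfolding L_def using that by (rule restrict_apply[THEN trans, OF if_not_P])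
  qed
  ultimately show ?thesis unfolding latin_squares_def by blast
qed

end

theory Submission
  imports Defs "HOL-Computational_Algebra.Fundamental_Theorem_Algebra" "HOL-Real_Asymp.Real_Asymp"
begin

text \<open>
  The proof compares two counts. Filling a Latin square row by row, the next row is a perfect
  matching of the bipartite graph that joins each column to the symbols it does not yet contain.
  After \<open>q\<close> rows of a square of order \<open>n\<close> this graph is regular of degree \<open>n - q\<close>, and the number
  of perfect matchings of a \<open>d\<close>-regular graph on \<open>n + n\<close> vertices is known up to a small factor:
  it is at most \<open>(d!) powr (n / d)\<close> (Bregman's theorem, \<open>bregman_minc\<close>) and at least \<open>(d / e) ^ n\<close>
  (\<open>regular_matchings_lower_bound\<close>, a weak form of the van der Waerden bound, proved by
  Gurvits's capacity method).

  By Stirling, \<open>(d!) powr (1 / d)\<close> exceeds \<open>d / e\<close> only by a factor \<open>exp (O (log n / d))\<close>. Over the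
  \<open>n\<close> entries of each of the \<open>n\<close> rows, of degrees \<open>d = n, ..., 1\<close>, these factors multiply to
  \<open>exp (O (n log\<^sup>2 n))\<close>: this is the total loss in passing between the upper and the lower bound.

  Let a set \<open>R\<close> of \<open>m\<close> rows, a set \<open>C\<close> of \<open>m\<close> columns and a set \<open>S\<close> of \<open>m\<close> symbols be given. If a
  Latin square has a subsquare there, then each row of \<open>R\<close> splits into a matching of \<open>C\<close> with \<open>S\<close> and
  one of the complements, so the bound for the row with \<open>k\<close> predecessors drops from about
  \<open>((n - k) / e) ^ n\<close> to about \<open>((m - k) / e) ^ m * ((n - m - k) / e) ^ (n - m)\<close>, which
  is smaller by a factor of at least \<open>(n / m) ^ m\<close>. Hence the proportion of Latin squares with this
  subsquare is at most \<open>exp (O (n log\<^sup>2 n)) * (m / n) ^ (m * m)\<close> (\<open>few_squares_with_given_subsquare\<close>).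

  A proper subsquare has order \<open>m \<le> n / 2\<close>. If moreover \<open>m \<ge> c * sqrt (n log n)\<close>, then
  \<open>m\<^sup>2 log (n / m)\<close> is at least a multiple of \<open>c\<^sup>2 n log\<^sup>2 n\<close>: for \<open>m \<le> n powr (3/4)\<close> because
  \<open>log (n / m)\<close> is then of order \<open>log n\<close>, and for larger \<open>m\<close> because of the size of \<open>m\<^sup>2\<close>.
  So a large \<open>c\<close> beats the loss, and it also beats the \<open>8 ^ n\<close> choices of \<open>(R, C, S)\<close> in a union bound.
\<close>

section \<open>Perfect matchings and Bregman's theorem\<close>

text \<open>
  The perfect matchings between \<open>D\<close> and \<open>C\<close> in the bipartite graph in which \<open>x\<close> is adjacent to \<open>N x\<close>.
  The set \<open>N x\<close> need not lie in \<open>C\<close>, so that deleting vertices leaves \<open>N\<close> unchanged. Functions are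
  extensional, so each matching is counted once.
\<close>

definition matchings :: "('a \<Rightarrow> 'b set) \<Rightarrow> 'a set \<Rightarrow> 'b set \<Rightarrow> ('a \<Rightarrow> 'b) set" where
  "matchings N D C = {f \<in> D \<rightarrow>\<^sub>E C. bij_betw f D C \<and> (\<forall>x\<in>D. f x \<in> N x)}"

lemma finite_matchings: "finite D \<Longrightarrow> finite C \<Longrightarrow> finite (matchings N D C)"
  unfolding matchings_def by (rule finite_subset[OF _ finite_PiE[of D "\<lambda>_. C"]]) auto

lemma card_matchings_fixed:
  assumes "i \<in> D" "k \<in> C \<inter> N i"
  shows "card {f \<in> matchings N D C. f i = k} = card (matchings N (D - {i}) (C - {k}))"
proof (rule bij_betw_same_card[OF bij_betw_byWitness[where f = "\<lambda>f. restrict f (D - {i})"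
      and f' = "\<lambda>g. g(i := k)"]])
  show "\<forall>f\<in>{f \<in> matchings N D C. f i = k}. (restrict f (D - {i}))(i := k) = f"
    by (auto simp: matchings_def fun_eq_iff PiE_iff extensional_def)
  show "\<forall>g\<in>matchings N (D - {i}) (C - {k}). restrict (g(i := k)) (D - {i}) = g"
    by (auto simp: matchings_def fun_eq_iff PiE_iff extensional_def restrict_def)
  show "(\<lambda>f. restrict f (D - {i})) ` {f \<in> matchings N D C. f i = k}
          \<subseteq> matchings N (D - {i}) (C - {k})"
  proof clarify
    fix f assume f: "f \<in> matchings N D C" "k = f i"
    then have bij: "bij_betw f D C" by (simp add: matchings_def)
    have "bij_betw f (D - {i}) (C - {f i})"
      using bij assms by (auto simp: bij_betw_def inj_on_def)
    then have bij': "bij_betw (restrict f (D - {i})) (D - {i}) (C - {f i})"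
      by (rule bij_betw_cong[THEN iffD1, rotated]) auto
    then have "restrict f (D - {i}) \<in> (D - {i}) \<rightarrow>\<^sub>E (C - {f i})"
      by (auto simp: bij_betw_def)
    then show "restrict f (D - {i}) \<in> matchings N (D - {i}) (C - {f i})"
      using f bij' by (auto simp: matchings_def)
  qed
  show "(\<lambda>g. g(i := k)) ` matchings N (D - {i}) (C - {k}) \<subseteq> {f \<in> matchings N D C. f i = k}"
  proof clarify
    fix g assume g: "g \<in> matchings N (D - {i}) (C - {k})"
    then have bij: "bij_betw g (D - {i}) (C - {k})" by (simp add: matchings_def)
    then have "bij_betw (g(i := k)) (D - {i}) (C - {k})"
      by (rule bij_betw_cong[THEN iffD1, rotated]) auto
    from bij_betw_combine[OF this, of "{i}" "{k}"]
    have bij': "bij_betw (g(i := k)) D C"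
      using assms by (simp add: insert_absorb)
    then have "g(i := k) \<in> D \<rightarrow>\<^sub>E C"
      using g assms by (auto simp: matchings_def PiE_iff extensional_def)
    then show "g(i := k) \<in> matchings N D C \<and> (g(i := k)) i = k"
      using g bij' assms by (auto simp: matchings_def)
  qed
qed

text \<open>
  Expansion of the permanent along a row, with weights: Bregman's argument needs the sum of
  \<open>ln\<close> of the cofactor selected by a matching, and not only the number of matchings.
\<close>

lemma sum_matchings_expand:
  fixes h :: "'b \<Rightarrow> real"
  assumes "finite D" "finite C" "i \<in> D"
  shows "(\<Sum>f\<in>matchings N D C. h (f i)) =
         (\<Sum>k\<in>C \<inter> N i. real (card (matchings N (D - {i}) (C - {k}))) * h k)"
proof -
  have "(\<Sum>f\<in>matchings N D C. h (f i)) =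
        (\<Sum>k\<in>C \<inter> N i. \<Sum>f\<in>{f \<in> matchings N D C. f i = k}. h (f i))"
    using assms by (intro sum.group[symmetric] finite_matchings) (auto simp: matchings_def)
  also have "\<dots> = (\<Sum>k\<in>C \<inter> N i. real (card {f \<in> matchings N D C. f i = k}) * h k)"
    by (intro sum.cong) auto
  also have "\<dots> = (\<Sum>k\<in>C \<inter> N i. real (card (matchings N (D - {i}) (C - {k}))) * h k)"
    using card_matchings_fixed[OF assms(3), of _ C N] by (intro sum.cong refl) simp
  finally show ?thesis .
qed

lemma card_matchings_expand:
  assumes "finite D" "finite C" "i \<in> D"
  shows "card (matchings N D C) = (\<Sum>k\<in>C \<inter> N i. card (matchings N (D - {i}) (C - {k})))"
proof -
  have "real (card (matchings N D C)) =
        real (\<Sum>k\<in>C \<inter> N i. card (matchings N (D - {i}) (C - {k})))"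
    using sum_matchings_expand[OF assms, of "\<lambda>_. 1" N] by simp
  then show ?thesis by (rule of_nat_eq_iff[THEN iffD1])
qed

text \<open>
  Convexity of \<open>x ln x\<close>. Since \<open>ln 0 = 0\<close>, vanishing terms follow the convention \<open>0 ln 0 = 0\<close>.
\<close>

lemma log_sum_le:
  fixes p :: "'a \<Rightarrow> real"
  assumes "finite K" and nonneg: "\<And>k. k \<in> K \<Longrightarrow> p k \<ge> 0" and pos: "sum p K > 0"
  shows "sum p K * ln (sum p K) \<le> sum p K * ln (card K) + (\<Sum>k\<in>K. p k * ln (p k))"
proof -
  have K: "card K > 0" using pos assms(1) by (auto simp: card_gt_0_iff)
  define S where "S = sum p K"
  have "p k * (ln S - ln (card K) - ln (p k)) \<le> S / card K - p k" if "k \<in> K" for k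
  proof (cases "p k = 0")
    case True
    then show ?thesis using pos by (simp add: S_def)
  next
    case False
    then have pk: "p k > 0" using nonneg[OF that] by simp
    have "ln S - ln (card K) - ln (p k) = ln (S / (card K * p k))"
      using pk K pos by (simp add: S_def ln_div ln_mult)
    also have "\<dots> \<le> S / (card K * p k) - 1"
      using pk K pos by (intro ln_le_minus_one) (simp add: S_def)
    finally have "p k * (ln S - ln (card K) - ln (p k)) \<le> p k * (S / (card K * p k) - 1)"
      using pk by (intro mult_left_mono) auto
    also have "\<dots> = S / card K - p k" using pk K by (simp add: field_simps)
    finally show ?thesis .
  qed
  then have "(\<Sum>k\<in>K. p k * (ln S - ln (card K) - ln (p k))) \<le> (\<Sum>k\<in>K. S / card K - p k)"
    by (rule sum_mono)
  also have "\<dots> = 0" using K by (simp add: sum_subtractf S_def)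
  also have "(\<Sum>k\<in>K. p k * (ln S - ln (card K) - ln (p k))) =
      S * ln S - S * ln (card K) - (\<Sum>k\<in>K. p k * ln (p k))"
    by (simp add: algebra_simps sum.distrib sum_subtractf S_def sum_distrib_left sum_distrib_right)
  finally show ?thesis by (simp add: S_def)
qed

text \<open>
  Schrijver's proof of the Bregman--Minc inequality. Convexity of \<open>x ln x\<close>, applied to the expansion
  along a row \<open>i\<close>, bounds \<open>M ln M\<close>, where \<open>M\<close> is the number of matchings, by \<open>M ln r\<^sub>i\<close> plus the sum
  over all matchings \<open>f\<close> of the logarithm of the cofactor of \<open>(i, f i)\<close>. Summing over the rows \<open>i\<close>
  and applying the induction hypothesis to the cofactors, every matching contributes the same amount:
  as \<open>i\<close> ranges over the rows other than \<open>j\<close>, deleting the vertex \<open>f i\<close> reduces the degree of \<open>j\<close>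
  exactly \<open>r\<^sub>j - 1\<close> times, whatever \<open>f\<close> is.
\<close>

theorem bregman_minc:
  assumes "finite D" "finite C" "matchings N D C \<noteq> {}"
  shows "ln (card (matchings N D C)) \<le>
         (\<Sum>x\<in>D. ln (fact (card (C \<inter> N x))) / card (C \<inter> N x))"
  using assms
proof (induction "card D" arbitrary: D C)
  case 0
  then have "matchings N D C \<subseteq> {\<lambda>_. undefined}" by (auto simp: matchings_def)
  then have "matchings N D C = {\<lambda>_. undefined}" using 0 by blast
  then show ?case using 0 by simp
next
  case (Suc n)
  define M where "M = matchings N D C"
  define P where "P = (\<lambda>i k. real (card (matchings N (D - {i}) (C - {k}))))"
  define r where "r = (\<lambda>x. card (C \<inter> N x))"
  define g where "g = (\<lambda>d::nat. ln (fact d :: real) / d)"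
  have fin: "finite D" "finite C" "finite M"
    using Suc.prems finite_matchings by (auto simp: M_def)
  have M: "real (card M) > 0" using Suc.prems(3) fin by (simp add: M_def card_gt_0_iff)
  have g: "real d * g d = ln (fact d)" for d by (simp add: g_def)
  have row: "card M * ln (card M) \<le> card M * ln (r i) + (\<Sum>f\<in>M. ln (P i (f i)))" if "i \<in> D" for i
  proof -
    have e: "real (card M) = sum (P i) (C \<inter> N i)"
      using card_matchings_expand[OF fin(1,2) that, of N] by (simp add: M_def P_def)
    have "(\<Sum>f\<in>M. ln (P i (f i))) = (\<Sum>k\<in>C \<inter> N i. P i k * ln (P i k))"
      using sum_matchings_expand[OF fin(1,2) that, of "\<lambda>k. ln (P i k)" N] by (simp add: M_def P_def)
    moreover have "sum (P i) (C \<inter> N i) * ln (sum (P i) (C \<inter> N i)) \<le>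
        sum (P i) (C \<inter> N i) * ln (card (C \<inter> N i)) + (\<Sum>k\<in>C \<inter> N i. P i k * ln (P i k))"
      using fin M e by (intro log_sum_le) (auto simp: P_def)
    ultimately show ?thesis using e by (simp add: r_def)
  qed
  have matching: "(\<Sum>i\<in>D. ln (P i (f i))) \<le> (\<Sum>j\<in>D. (real (card D) * g (r j) - ln (r j)))"
    if f: "f \<in> M" for f
  proof -
    have bij: "bij_betw f D C" and fN: "\<And>i. i \<in> D \<Longrightarrow> f i \<in> N i"
      using f by (auto simp: M_def matchings_def)
    have fC: "f i \<in> C" if "i \<in> D" for i using bij that by (auto simp: bij_betw_def)
    have "ln (P i (f i)) \<le> (\<Sum>j\<in>D - {i}. g (card ((C - {f i}) \<inter> N j)))" if i: "i \<in> D" for i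
      unfolding P_def g_def
    proof (rule Suc.hyps(1))
      show "n = card (D - {i})" using Suc.hyps(2) i fin by simp
      have "{h \<in> matchings N D C. h i = f i} \<noteq> {}" using f by (auto simp: M_def)
      then have "card {h \<in> matchings N D C. h i = f i} > 0"
        using fin by (subst card_gt_0_iff) (auto simp: M_def)
      then show "matchings N (D - {i}) (C - {f i}) \<noteq> {}"
        using card_matchings_fixed[of i D "f i" C N] i fC fN by auto
    qed (use fin in auto)
    then have "(\<Sum>i\<in>D. ln (P i (f i))) \<le> (\<Sum>i\<in>D. \<Sum>j\<in>D - {i}. g (card ((C - {f i}) \<inter> N j)))"
      by (rule sum_mono)
    also have "\<dots> = (\<Sum>i\<in>D. \<Sum>j | j \<in> D \<and> j \<noteq> i. g (card ((C - {f i}) \<inter> N j)))"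
      by (intro sum.cong) auto
    also have "\<dots> = (\<Sum>j\<in>D. \<Sum>i | i \<in> D \<and> j \<noteq> i. g (card ((C - {f i}) \<inter> N j)))"
      using fin by (intro sum.swap_restrict)
    also have "\<dots> = (\<Sum>j\<in>D. real (card D) * g (r j) - ln (r j))"
    proof (rule sum.cong[OF refl])
      fix j assume j: "j \<in> D"
      have rpos: "r j > 0" using fC[OF j] fN[OF j] fin by (auto simp: r_def card_gt_0_iff)
      have cnt: "card {i \<in> D. f i \<in> N j} = r j"
      proof -
        have "bij_betw f {i \<in> D. f i \<in> N j} (C \<inter> N j)"
          using bij by (auto simp: bij_betw_def inj_on_def)
        then show ?thesis by (simp add: bij_betw_same_card r_def)
      qed
      have cnt1: "card {i \<in> D. j \<noteq> i \<and> f i \<in> N j} = r j - 1"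
      proof -
        have "{i \<in> D. j \<noteq> i \<and> f i \<in> N j} = {i \<in> D. f i \<in> N j} - {j}" by auto
        then show ?thesis using cnt j fN by simp
      qed
      have cnt2: "card {i \<in> D. j \<noteq> i \<and> f i \<notin> N j} = card D - r j"
      proof -
        have "{i \<in> D. j \<noteq> i \<and> f i \<notin> N j} = D - {i \<in> D. f i \<in> N j}" using fN by auto
        then show ?thesis using cnt fin by (simp add: card_Diff_subset)
      qed
      have rle: "r j \<le> card D" using cnt fin by (metis (no_types, lifting) card_mono mem_Collect_eq subsetI)
      have "(\<Sum>i | i \<in> D \<and> j \<noteq> i. g (card ((C - {f i}) \<inter> N j))) =
            (\<Sum>i\<in>{i \<in> D. j \<noteq> i \<and> f i \<in> N j} \<union> {i \<in> D. j \<noteq> i \<and> f i \<notin> N j}.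
               g (card ((C - {f i}) \<inter> N j)))"
        by (intro sum.cong) auto
      also have "\<dots> = (\<Sum>i | i \<in> D \<and> j \<noteq> i \<and> f i \<in> N j. g (card ((C - {f i}) \<inter> N j))) +
          (\<Sum>i | i \<in> D \<and> j \<noteq> i \<and> f i \<notin> N j. g (card ((C - {f i}) \<inter> N j)))"
        using fin by (intro sum.union_disjoint) auto
      also have "(\<Sum>i | i \<in> D \<and> j \<noteq> i \<and> f i \<in> N j. g (card ((C - {f i}) \<inter> N j))) =
          (\<Sum>i | i \<in> D \<and> j \<noteq> i \<and> f i \<in> N j. g (r j - 1))"
      proof (intro sum.cong refl arg_cong[where f = g])
        fix i assume "i \<in> {i. i \<in> D \<and> j \<noteq> i \<and> f i \<in> N j}"
        moreover have "(C - {f i}) \<inter> N j = C \<inter> N j - {f i}" by auto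
        ultimately show "card ((C - {f i}) \<inter> N j) = r j - 1"
          using fC fin by (simp add: r_def)
      qed
      also have "(\<Sum>i | i \<in> D \<and> j \<noteq> i \<and> f i \<notin> N j. g (card ((C - {f i}) \<inter> N j))) =
          (\<Sum>i | i \<in> D \<and> j \<noteq> i \<and> f i \<notin> N j. g (r j))"
        unfolding r_def by (intro sum.cong refl arg_cong[where f = g] arg_cong[where f = card]) auto
      finally have "(\<Sum>i | i \<in> D \<and> j \<noteq> i. g (card ((C - {f i}) \<inter> N j))) =
          real (r j - 1) * g (r j - 1) + real (card D - r j) * g (r j)"
        by (simp add: cnt1 cnt2)
      \<comment> \<open>The mean \<open>g\<close> makes both multiplicities collapse: \<open>d * g d = ln (fact d)\<close> for \<open>d = r j - 1\<close> and \<open>d = r j\<close>.\<close>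
      also have "\<dots> = ln (fact (r j - 1)) + (real (card D) * g (r j) - ln (fact (r j)))"
        using rle by (simp add: g of_nat_diff left_diff_distrib)
      also have "ln (fact (r j) :: real) = ln (r j) + ln (fact (r j - 1))"
        using rpos by (subst fact_reduce) (auto simp: ln_mult)
      finally show "(\<Sum>i | i \<in> D \<and> j \<noteq> i. g (card ((C - {f i}) \<inter> N j))) =
          real (card D) * g (r j) - ln (r j)" by simp
    qed
    finally show ?thesis .
  qed
  have "real (card D) * (card M * ln (card M)) = (\<Sum>i\<in>D. card M * ln (card M))" by simp
  also have "\<dots> \<le> (\<Sum>i\<in>D. card M * ln (r i) + (\<Sum>f\<in>M. ln (P i (f i))))"
    by (intro sum_mono row)
  also have "\<dots> = card M * (\<Sum>i\<in>D. ln (r i)) + (\<Sum>f\<in>M. \<Sum>i\<in>D. ln (P i (f i)))"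
    by (simp add: sum.distrib sum_distrib_left sum.swap[of _ D])
  also have "\<dots> \<le> card M * (\<Sum>i\<in>D. ln (r i)) +
      (\<Sum>f\<in>M. \<Sum>j\<in>D. (real (card D) * g (r j) - ln (r j)))"
    by (intro add_left_mono sum_mono matching)
  also have "\<dots> = real (card D) * (card M * (\<Sum>j\<in>D. g (r j)))"
    by (simp add: sum_subtractf sum_distrib_left algebra_simps)
  finally have "card M * ln (card M) \<le> card M * (\<Sum>j\<in>D. g (r j))"
    using Suc.hyps(2) by (simp add: mult_le_cancel_left_pos)
  then have "ln (card M) \<le> (\<Sum>j\<in>D. g (r j))" using M by (simp add: mult_le_cancel_left_pos)
  then show ?case by (simp add: M_def g_def r_def)
qed

section \<open>A lower bound for matchings of regular graphs\<close>

text \<open>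
  This is the polynomial obtained from the product of the variables \<open>y i\<close>, \<open>i \<in> R\<close>, by
  differentiating in the directions \<open>bs\<close>. With as many directions as variables it is a
  constant, the permanent of the matrix with columns \<open>bs\<close>. The ring is left general because the
  same expression is needed over the reals, over the complex numbers and over polynomials.
\<close>

fun mixed_derivative :: "('a \<Rightarrow> 'r::comm_semiring_1) list \<Rightarrow> 'a set \<Rightarrow> ('a \<Rightarrow> 'r) \<Rightarrow> 'r" where
  "mixed_derivative [] R y = (\<Prod>i\<in>R. y i)"
| "mixed_derivative (b # bs) R y = (\<Sum>i\<in>R. b i * mixed_derivative bs (R - {i}) y)"

lemma mixed_derivative_swap:
  assumes "finite R"
  shows "mixed_derivative (b # c # bs) R y = mixed_derivative (c # b # bs) R y"
proof -
  have expand: "mixed_derivative (b # c # bs) R y =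
      (\<Sum>i\<in>R. \<Sum>j | j \<in> R \<and> j \<noteq> i. b i * c j * mixed_derivative bs (R - {i} - {j}) y)" for b c
    by (auto simp: sum_distrib_left mult.assoc intro!: sum.cong)
  have "mixed_derivative (b # c # bs) R y =
      (\<Sum>j\<in>R. \<Sum>i | i \<in> R \<and> j \<noteq> i. b i * c j * mixed_derivative bs (R - {i} - {j}) y)"
    unfolding expand using assms by (intro sum.swap_restrict)
  also have "\<dots> = (\<Sum>j\<in>R. \<Sum>i | i \<in> R \<and> i \<noteq> j. c j * b i * mixed_derivative bs (R - {j} - {i}) y)"
  proof (intro sum.cong)
    fix i j
    have "R - {i} - {j} = R - {j} - {i}" by blast
    then show "b i * c j * mixed_derivative bs (R - {i} - {j}) y =
        c j * b i * mixed_derivative bs (R - {j} - {i}) y" by (simp only: mult.commute)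
  qed auto
  finally show ?thesis unfolding expand .
qed

text \<open>
  Instances are evaluation of polynomials, complex conjugation and the embedding of the reals.
\<close>

lemma mixed_derivative_hom:
  fixes h :: "'r::comm_semiring_1 \<Rightarrow> 's::comm_semiring_1"
  assumes "h 0 = 0" "h 1 = 1" "\<And>x y. h (x + y) = h x + h y" "\<And>x y. h (x * y) = h x * h y"
  shows "h (mixed_derivative bs R y) = mixed_derivative (map (\<lambda>b i. h (b i)) bs) R (\<lambda>i. h (y i))"
proof (induction bs arbitrary: R)
  case Nil
  show ?case
    by (induction R rule: infinite_finite_induct) (auto simp: assms)
next
  case (Cons b bs)
  have "h (sum f R) = (\<Sum>i\<in>R. h (f i))" for f
    by (induction R rule: infinite_finite_induct) (auto simp: assms)
  then show ?case by (simp add: assms Cons)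
qed

lemma mixed_derivative_pos:
  fixes y :: "'a \<Rightarrow> real"
  assumes "finite R" "length bs \<le> card R" "\<And>b i. b \<in> set bs \<Longrightarrow> i \<in> R \<Longrightarrow> b i > 0"
    "\<And>i. i \<in> R \<Longrightarrow> y i > 0"
  shows "mixed_derivative bs R y > 0"
  using assms
proof (induction bs arbitrary: R)
  case Nil
  then show ?case by (auto intro: prod_pos)
next
  case (Cons b bs)
  have "R \<noteq> {}" using Cons.prems by auto
  moreover have "b i * mixed_derivative bs (R - {i}) y > 0" if "i \<in> R" for i
    using that Cons.prems by (intro mult_pos_pos Cons.IH) auto
  ultimately show ?case using Cons.prems(1) by (auto intro: sum_pos)
qed

text \<open>
  The restriction of the mixed derivative to the line \<open>y + s a\<close>, as a polynomial in \<open>s\<close>.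
\<close>

definition along_line ::
  "('a \<Rightarrow> 'r::comm_ring_1) list \<Rightarrow> 'a set \<Rightarrow> ('a \<Rightarrow> 'r) \<Rightarrow> ('a \<Rightarrow> 'r) \<Rightarrow> 'r poly" where
  "along_line bs R y a = mixed_derivative (map (\<lambda>b i. [:b i:]) bs) R (\<lambda>i. [:y i, a i:])"

lemma poly_along_line:
  "poly (along_line bs R y a) s = mixed_derivative bs R (\<lambda>i. y i + s * a i)"
  unfolding along_line_def
  by (subst mixed_derivative_hom[where h = "\<lambda>p. poly p s"]) (simp_all add: comp_def)

text \<open>
  Differentiating along the line adds its direction to the list. All the analysis below can
  therefore be done with polynomials in one variable.
\<close>

lemma pderiv_along_line:
  fixes y :: "'a \<Rightarrow> 'r::idom"
  assumes "finite R"
  shows "pderiv (along_line bs R y a) = along_line (a # bs) R y a"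
  using assms
proof (induction bs arbitrary: R)
  case Nil
  then show ?case by (simp add: along_line_def pderiv_prod pderiv_pCons mult.commute)
next
  case (Cons b bs)
  have "pderiv (sum f R) = (\<Sum>i\<in>R. pderiv (f i))" for f :: "'a \<Rightarrow> 'r poly"
    by (induction R rule: infinite_finite_induct) (auto simp: pderiv_add)
  then have "pderiv (along_line (b # bs) R y a) =
      (\<Sum>i\<in>R. [:b i:] * pderiv (along_line bs (R - {i}) y a))"
    by (simp add: along_line_def pderiv_smult pderiv_pCons)
  also have "\<dots> = along_line (b # a # bs) R y a"
    using Cons by (simp add: along_line_def)
  also have "\<dots> = along_line (a # b # bs) R y a"
    unfolding along_line_def list.map by (rule mixed_derivative_swap[OF Cons.prems])
  finally show ?case .
qed

lemma coeff_along_line: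
  fixes y :: "'a \<Rightarrow> 'r::idom"
  assumes "finite R" "length bs \<le> card R" "\<And>i. i \<in> R \<Longrightarrow> a i \<noteq> 0"
  shows "coeff (along_line bs R y a) (card R - length bs) = mixed_derivative bs R a"
  using assms
proof (induction bs arbitrary: R)
  case Nil
  have "degree (\<Prod>i\<in>R. [:y i, a i:]) = card R"
    using Nil by (subst degree_prod_eq_sum_degree) auto
  moreover have "lead_coeff (\<Prod>i\<in>R. [:y i, a i:]) = (\<Prod>i\<in>R. a i)"
    using Nil by (subst lead_coeff_prod) (auto intro!: prod.cong)
  ultimately show ?case by (simp add: along_line_def)
next
  case (Cons b bs)
  have "coeff (along_line (b # bs) R y a) k = (\<Sum>i\<in>R. b i * coeff (along_line bs (R - {i}) y a) k)"
    for k by (simp add: along_line_def coeff_sum)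
  also have "(\<Sum>i\<in>R. b i * coeff (along_line bs (R - {i}) y a) (card R - length (b # bs))) =
     (\<Sum>i\<in>R. b i * mixed_derivative bs (R - {i}) a)"
  proof (intro sum.cong refl)
    fix i assume i: "i \<in> R"
    then have "card R - length (b # bs) = card (R - {i}) - length bs"
      using Cons.prems(1) by simp
    then show "b i * coeff (along_line bs (R - {i}) y a) (card R - length (b # bs)) =
        b i * mixed_derivative bs (R - {i}) a"
      using Cons.IH[of "R - {i}"] Cons.prems i by simp
  qed
  finally show ?case by simp
qed

lemma pderiv_root_product:
  fixes A :: "'a::field_char_0 multiset"
  shows "poly (pderiv (smult c (\<Prod>z\<in>#A. [:1, - (1 / z):]))) 0 = - c * (\<Sum>z\<in>#A. 1 / z)"
    and "poly (\<Prod>z\<in>#A. [:1, - (1 / z):]) 0 = 1"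
proof -
  show *: "poly (\<Prod>z\<in>#A. [:1, - (1 / z):]) 0 = 1" for A :: "'a multiset" by (induction A) auto
  have "poly (pderiv (\<Prod>z\<in>#A. [:1, - (1 / z):])) 0 = - (\<Sum>z\<in>#A. 1 / z)"
    by (induction A) (auto simp: pderiv_mult pderiv_pCons * simp del: mult_pCons_left)
  then show "poly (pderiv (smult c (\<Prod>z\<in>#A. [:1, - (1 / z):]))) 0 = - c * (\<Sum>z\<in>#A. 1 / z)"
    by (simp add: pderiv_smult)
qed

text \<open>
  Factorisation normalised at \<open>0\<close>, which turns the logarithmic derivative at \<open>0\<close> into
  a sum over the roots.
\<close>

lemma complex_poly_root_product:
  fixes p :: "complex poly"
  assumes "poly p 0 \<noteq> 0"
  obtains A where "size A = degree p" "\<And>z. z \<in># A \<Longrightarrow> poly p z = 0"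
    "\<And>s. poly p s = poly p 0 * (\<Prod>z\<in>#A. 1 - s / z)"
    "poly (pderiv p) 0 = - poly p 0 * (\<Sum>z\<in>#A. 1 / z)"
proof -
  have "p \<noteq> 0" using assms by auto
  then obtain A where A: "size A = degree p" "p = smult (lead_coeff p) (\<Prod>x\<in>#A. [:-x, 1:])"
    using alg_closed_imp_factorization[of p] by auto
  have root: "poly p z = 0" if "z \<in># A" for z
  proof -
    have "[:-z, 1:] dvd (\<Prod>x\<in>#A. [:-x, 1:])" using that by (intro dvd_prod_mset) auto
    then have "[:-z, 1:] dvd p" by (subst A(2)) (rule dvd_smult)
    then show ?thesis by (simp add: poly_eq_0_iff_dvd)
  qed
  have nz: "z \<noteq> 0" if "z \<in># A" for z using root[OF that] assms by auto
  have factor: "(\<Prod>x\<in>#B. [:-x, 1:]) = smult (\<Prod>x\<in>#B. - x) (\<Prod>x\<in>#B. [:1, - (1 / x):])"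
    if "\<And>z. z \<in># B \<Longrightarrow> z \<noteq> 0" for B :: "complex multiset"
    using that
  proof (induction B)
    case (add x B)
    have "[:-x, 1:] = smult (- x) [:1, - (1 / x):]" using add.prems by simp
    then show ?case using add by (simp add: mult_ac del: mult_pCons_left smult_pCons)
  qed simp
  define c where "c = lead_coeff p * (\<Prod>x\<in>#A. - x)"
  have c: "p = smult c (\<Prod>x\<in>#A. [:1, - (1 / x):])"
    by (rule trans[OF A(2)]) (simp only: factor[OF nz] smult_smult c_def)
  have c0: "poly p 0 = c"
    by (rule trans[OF arg_cong[OF c, of "\<lambda>p. poly p 0"]]) (simp add: pderiv_root_product(2))
  show ?thesis
  proof (rule that[OF A(1) root])
    show "poly p s = poly p 0 * (\<Prod>z\<in>#A. 1 - s / z)" for s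
    proof -
      have "poly (\<Prod>z\<in>#A. [:1, - (1 / z):]) s = (\<Prod>z\<in>#A. 1 - s / z)"
      proof (induction A)
        case (add z A)
        have "poly [:1, - (1 / z):] s = 1 - s / z" by simp
        then show ?case by (simp only: image_mset_add_mset prod_mset.add_mset poly_mult add)
      qed simp
      then have "poly p s = c * (\<Prod>z\<in>#A. 1 - s / z)"
        using arg_cong[OF c, of "\<lambda>p. poly p s"] by simp
      then show ?thesis using c0 by simp
    qed
    show "poly (pderiv p) 0 = - poly p 0 * (\<Sum>z\<in>#A. 1 / z)"
      using arg_cong[OF c, of "\<lambda>p. poly (pderiv p) 0"] c0
      by (simp only: pderiv_root_product(1))
  qed
qed

abbreviation cplx :: "('a \<Rightarrow> real) \<Rightarrow> 'a \<Rightarrow> complex" where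
  "cplx b \<equiv> \<lambda>i. of_real (b i)"

text \<open>
  Stability: there are no zeros in the product of upper half planes. By induction, the polynomial
  \<open>p\<close> along a positive direction through such a point has all its roots in the open lower half plane.
  Therefore \<open>p' / p\<close> at \<open>0\<close>, which is minus the sum of the inverses of the roots, has negative imaginary
  part and does not vanish; this is the argument of Gauss and Lucas. Strict positivity of the
  directions guarantees that \<open>p\<close> is not constant.
\<close>

theorem mixed_derivative_stable:
  fixes y :: "'a \<Rightarrow> complex"
  assumes "finite R" "length bs \<le> card R" "\<And>b i. b \<in> set bs \<Longrightarrow> i \<in> R \<Longrightarrow> b i > 0"
    "\<And>i. i \<in> R \<Longrightarrow> Im (y i) > 0"
  shows "mixed_derivative (map cplx bs) R y \<noteq> 0"
  using assms(2-)
proof (induction bs arbitrary: y)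
  case Nil
  then show ?case using assms(1) by force
next
  case (Cons b bs)
  define p where "p = along_line (map cplx bs) R y (cplx b)"
  have nonzero: "poly p s \<noteq> 0" if "Im s \<ge> 0" for s
    unfolding p_def poly_along_line
  proof (rule Cons.IH)
    show "Im (y i + s * of_real (b i)) > 0" if "i \<in> R" for i
      using Cons.prems(2)[of b i] Cons.prems(3)[of i] \<open>Im s \<ge> 0\<close> that
      by (auto intro: add_pos_nonneg)
  qed (use Cons.prems in auto)
  have "poly p 0 \<noteq> 0" using nonzero[of 0] by simp
  then obtain A where A: "size A = degree p" "\<And>z. z \<in># A \<Longrightarrow> poly p z = 0"
    "\<And>s. poly p s = poly p 0 * (\<Prod>z\<in>#A. 1 - s / z)"
    "poly (pderiv p) 0 = - poly p 0 * (\<Sum>z\<in>#A. 1 / z)"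
    by (rule complex_poly_root_product) blast
  have "degree p > 0"
  proof -
    have "coeff p (card R - length bs) = mixed_derivative (map cplx bs) R (cplx b)"
      unfolding p_def using coeff_along_line[of R "map cplx bs" "cplx b" y] assms(1) Cons.prems
      by fastforce
    also have "\<dots> = of_real (mixed_derivative bs R b)"
      by (subst mixed_derivative_hom) auto
    also have "\<dots> \<noteq> 0"
      using mixed_derivative_pos[of R bs b] assms(1) Cons.prems by fastforce
    finally have "card R - length bs \<le> degree p" by (rule le_degree)
    then show ?thesis using Cons.prems(1) by simp
  qed
  then have "A \<noteq> {#}" using A(1) by auto
  have neg: "Im z < 0" if "z \<in># A" for z
    using nonzero A(2)[OF that] by (meson not_le)
  have "Im (\<Sum>z\<in>#B. 1 / z) > 0" if "B \<noteq> {#}" "\<And>z. z \<in># B \<Longrightarrow> Im z < 0" for B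
    using that
  proof (induction B)
    case (add z B)
    have "Im (1 / z) > 0"
    proof -
      have "Im z < 0" using add.prems(2)[of z] by simp
      moreover from this have "(cmod z)\<^sup>2 > 0" by auto
      moreover have "Im (1 / z) = - Im z / (cmod z)\<^sup>2" by (simp add: Im_divide cmod_power2)
      ultimately show ?thesis by (simp add: divide_neg_pos)
    qed
    then show ?case using add by (cases "B = {#}") auto
  qed simp
  from this[OF \<open>A \<noteq> {#}\<close> neg] have "(\<Sum>z\<in>#A. 1 / z) \<noteq> 0"
    by (metis less_irrefl zero_complex.sel(2))
  then have "poly (pderiv p) 0 \<noteq> 0" using A(4) nonzero[of 0] by simp
  then show ?case
    unfolding p_def pderiv_along_line[OF assms(1)] poly_along_line by simp
qed

text \<open>
  Log-concavity along positive lines. By stability the polynomial in \<open>t\<close> has only real roots, and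
  positivity forces these to be negative, so it is a product of factors \<open>1 + t / w\<close> with
  \<open>w > 0\<close>, each at most \<open>exp (t / w)\<close>.
\<close>

lemma mixed_derivative_le_exp:
  fixes u a :: "'a \<Rightarrow> real"
  assumes "finite R" "length bs \<le> card R" and pos: "\<And>b i. b \<in> set bs \<Longrightarrow> i \<in> R \<Longrightarrow> b i > 0"
    "\<And>i. i \<in> R \<Longrightarrow> u i > 0" "\<And>i. i \<in> R \<Longrightarrow> a i > 0" and "t \<ge> 0"
  shows "mixed_derivative bs R (\<lambda>i. u i + t * a i) \<le>
    mixed_derivative bs R u * exp (t * (mixed_derivative (a # bs) R u / mixed_derivative bs R u))"
proof -
  define p where "p = along_line (map cplx bs) R (cplx u) (cplx a)"
  have p: "poly p s = mixed_derivative (map cplx bs) R (\<lambda>i. of_real (u i) + s * of_real (a i))" for s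
    by (simp add: p_def poly_along_line)
  have real: "poly p (of_real s) = of_real (mixed_derivative bs R (\<lambda>i. u i + s * a i))" for s
    by (subst mixed_derivative_hom[where h = of_real]) (auto simp: p)
  have real': "poly (pderiv p) 0 = of_real (mixed_derivative (a # bs) R u)"
    unfolding p_def pderiv_along_line[OF assms(1)] poly_along_line
    by (subst mixed_derivative_hom[where h = of_real]) auto
  have cnj: "poly p (cnj s) = cnj (poly p s)" for s
    unfolding p by (subst mixed_derivative_hom[where h = cnj]) (auto simp: comp_def)
  have upper: "poly p s \<noteq> 0" if "Im s > 0" for s
    unfolding p using assms(1,2) pos that by (intro mixed_derivative_stable) auto
  have rpos: "mixed_derivative bs R (\<lambda>i. u i + s * a i) > 0" if "s \<ge> 0" for s
    using assms(1,2) pos that by (intro mixed_derivative_pos) (auto intro!: add_pos_nonneg simp: less_imp_le)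
  define r0 r1 where "r0 = mixed_derivative bs R u" "r1 = mixed_derivative (a # bs) R u"
  have r0: "r0 > 0" "poly p 0 = of_real r0" using rpos[of 0] real[of 0] by (auto simp: r0_r1_def)
  have "poly p 0 \<noteq> 0" using r0 by simp
  then obtain A where A: "size A = degree p" "\<And>z. z \<in># A \<Longrightarrow> poly p z = 0"
    "\<And>s. poly p s = poly p 0 * (\<Prod>z\<in>#A. 1 - s / z)"
    "poly (pderiv p) 0 = - poly p 0 * (\<Sum>z\<in>#A. 1 / z)"
    by (rule complex_poly_root_product) blast
  have root: "Im z = 0" "Re z < 0" if "z \<in># A" for z
  proof -
    have "\<not> Im z > 0" "\<not> Im z < 0"
      using upper[of z] upper[of "cnj z"] A(2)[OF that] cnj[of z] by auto
    then show "Im z = 0" by simp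
    then have "z = of_real (Re z)" by (simp add: complex_eq_iff)
    then show "Re z < 0"
      using rpos[of "Re z"] real[of "Re z"] A(2)[OF that]
      by (metis less_irrefl not_le of_real_eq_0_iff)
  qed
  have bound: "norm (\<Prod>z\<in>#B. 1 - of_real t / z) \<le> exp (t * - Re (\<Sum>z\<in>#B. 1 / z))"
    if "\<And>z. z \<in># B \<Longrightarrow> Im z = 0 \<and> Re z < 0" for B
    using that
  proof (induction B)
    case (add z B)
    have z: "z = of_real (Re z)" "Re z < 0" using add.prems[of z] by (auto simp: complex_eq_iff)
    have "norm (1 - of_real t / z) = \<bar>1 - t / Re z\<bar>"
      by (subst z(1)) (metis norm_of_real of_real_1 of_real_diff of_real_divide)
    also have "\<dots> = 1 + (- t / Re z)" using z(2) \<open>t \<ge> 0\<close> by (simp add: abs_if field_simps)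
    also have "\<dots> \<le> exp (- t / Re z)" by (rule exp_ge_add_one_self)
    also have "- t / Re z = t * - Re (1 / z)" by (subst (2) z(1)) (simp add: Re_divide power2_eq_square)
    finally have "norm (1 - of_real t / z) \<le> exp (t * - Re (1 / z))" .
    then have "norm (1 - of_real t / z) * norm (\<Prod>z\<in>#B. 1 - of_real t / z) \<le>
        exp (t * - Re (1 / z)) * exp (t * - Re (\<Sum>z\<in>#B. 1 / z))"
      using add by (intro mult_mono) auto
    also have "\<dots> = exp (t * - Re (\<Sum>z\<in>#add_mset z B. 1 / z))"
      by (simp add: exp_add[symmetric] algebra_simps)
    finally show ?case by (simp only: image_mset_add_mset prod_mset.add_mset norm_mult)
  qed simp
  have "of_real r1 = - of_real r0 * (\<Sum>z\<in>#A. 1 / z)"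
    using A(4) r0(2) real' by (simp add: r0_r1_def)
  then have "(\<Sum>z\<in>#A. 1 / z) = of_real (- (r1 / r0))" using r0(1) by (simp add: field_simps)
  then have slope: "- Re (\<Sum>z\<in>#A. 1 / z) = r1 / r0" by simp
  have "mixed_derivative bs R (\<lambda>i. u i + t * a i) = norm (poly p (of_real t))"
    using real[of t] rpos[OF \<open>t \<ge> 0\<close>] by simp
  also have "\<dots> = r0 * norm (\<Prod>z\<in>#A. 1 - of_real t / z)"
    using A(3)[of "of_real t"] r0 by (simp add: norm_mult)
  also have "\<dots> \<le> r0 * exp (t * (r1 / r0))"
    using bound[of A] root r0(1) slope by (intro mult_left_mono) auto
  finally show ?thesis by (simp add: r0_r1_def)
qed

text \<open>
  Gurvits's inequality: differentiating in one variable at \<open>0\<close> costs a factor at most \<open>e\<close> in the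
  capacity. With \<open>r0\<close> and \<open>r1\<close> the value and the slope at \<open>t = 0\<close>, the exponential bound at
  the point \<open>t = r0 / r1\<close> reads \<open>K * r0 / r1 \<le> r0 * e\<close>.
\<close>

lemma capacity_step:
  fixes u a :: "'a \<Rightarrow> real"
  assumes "finite R" "length bs < card R" and pos: "\<And>b i. b \<in> set bs \<Longrightarrow> i \<in> R \<Longrightarrow> b i > 0"
    "\<And>i. i \<in> R \<Longrightarrow> u i > 0" "\<And>i. i \<in> R \<Longrightarrow> a i > 0"
    and lower: "\<And>t. t > 0 \<Longrightarrow> K * t \<le> mixed_derivative bs R (\<lambda>i. u i + t * a i)"
  shows "K / exp 1 \<le> mixed_derivative (a # bs) R u"
proof -
  define r0 r1 where "r0 = mixed_derivative bs R u" "r1 = mixed_derivative (a # bs) R u"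
  have r: "r0 > 0" "r1 > 0"
    unfolding r0_r1_def using assms(1,2) pos by (intro mixed_derivative_pos; force)+
  have "K * (r0 / r1) \<le> mixed_derivative bs R (\<lambda>i. u i + (r0 / r1) * a i)"
    using r by (intro lower) simp
  also have "\<dots> \<le> r0 * exp ((r0 / r1) * (r1 / r0))"
    unfolding r0_r1_def using assms(1,2) pos r
    by (intro mixed_derivative_le_exp) (auto simp: r0_r1_def)
  also have "(r0 / r1) * (r1 / r0) = 1" using r by simp
  finally have "K / exp 1 \<le> r1" using r by (simp add: field_simps)
  then show ?thesis by (simp only: r0_r1_def)
qed

text \<open>
  The hypothesis bounds below the capacity of a polynomial in the variables \<open>x c\<close>; one step of Gurvits's
  inequality moves a column from the variables to the directions. The shift \<open>w\<close> keeps the base point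
  positive when the last variable is removed, and the permanent reached at the end does not depend on it.
\<close>

lemma capacity_le_mixed_derivative:
  fixes a :: "'c \<Rightarrow> 'a \<Rightarrow> real"
  assumes "finite R" "distinct cs" "length cs + length ds \<le> card R"
    and pos: "\<And>c i. i \<in> R \<Longrightarrow> a c i > 0" "\<And>i. i \<in> R \<Longrightarrow> w i > 0"
    and lower: "\<And>x. (\<And>c. x c > 0) \<Longrightarrow> K * (\<Prod>c\<in>set cs. x c) \<le>
       mixed_derivative (map a ds) R (\<lambda>i. w i + (\<Sum>c\<in>set cs. x c * a c i))"
  shows "K / exp 1 ^ length cs \<le> mixed_derivative (map a (rev cs @ ds)) R w"
  using assms(2,3) lower
proof (induction cs arbitrary: ds K)
  case Nil
  show ?case using Nil.prems(3)[of "\<lambda>_. 1"] by simp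
next
  case (Cons c cs)
  have "K / exp 1 / exp 1 ^ length cs \<le> mixed_derivative (map a (rev cs @ c # ds)) R w"
  proof (rule Cons.IH)
    fix x :: "'c \<Rightarrow> real" assume x: "\<And>c. x c > 0"
    have "(K * (\<Prod>c\<in>set cs. x c)) / exp 1 \<le>
        mixed_derivative (a c # map a ds) R (\<lambda>i. w i + (\<Sum>c\<in>set cs. x c * a c i))"
    proof (rule capacity_step)
      fix t :: real assume t: "t > 0"
      have c: "c \<notin> set cs" using Cons.prems by simp
      have "K * (\<Prod>c'\<in>set (c # cs). (x(c := t)) c') \<le> mixed_derivative (map a ds) R
          (\<lambda>i. w i + (\<Sum>c'\<in>set (c # cs). (x(c := t)) c' * a c' i))"
        using x t by (intro Cons.prems(3)) auto
      also have "(\<Prod>c'\<in>set (c # cs). (x(c := t)) c') = t * (\<Prod>c'\<in>set cs. x c')"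
        using c by (auto intro!: arg_cong2[where f = "(*)"] prod.cong)
      also have "(\<lambda>i. w i + (\<Sum>c'\<in>set (c # cs). (x(c := t)) c' * a c' i)) =
          (\<lambda>i. w i + (\<Sum>c'\<in>set cs. x c' * a c' i) + t * a c i)"
        using c by (auto intro!: sum.cong simp: fun_eq_iff)
      finally show "K * (\<Prod>c\<in>set cs. x c) * t \<le> mixed_derivative (map a ds) R
          (\<lambda>i. w i + (\<Sum>c\<in>set cs. x c * a c i) + t * a c i)" by (simp add: mult_ac)
    qed (use assms(1) Cons.prems pos x in \<open>auto intro!: add_pos_nonneg sum_nonneg mult_nonneg_nonneg
          simp: less_imp_le\<close>)
    then show "K / exp 1 * (\<Prod>c\<in>set cs. x c) \<le>
        mixed_derivative (map a (c # ds)) R (\<lambda>i. w i + (\<Sum>c\<in>set cs. x c * a c i))" by simp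
  qed (use Cons.prems in auto)
  then show ?case by (simp add: field_simps)
qed

lemma weighted_amgm:
  fixes x :: "'c \<Rightarrow> real"
  assumes "finite C" "\<And>c. c \<in> C \<Longrightarrow> a c \<ge> 0" "\<And>c. x c > 0" "(\<Sum>c\<in>C. a c) = d" "d > 0"
  shows "d * exp (\<Sum>c\<in>C. a c / d * ln (x c)) \<le> (\<Sum>c\<in>C. x c * a c)"
proof -
  have "C \<noteq> {}" using assms(4,5) by auto
  have "exp (\<Sum>c\<in>C. (a c / d) *\<^sub>R ln (x c)) \<le> (\<Sum>c\<in>C. a c / d * exp (ln (x c)))"
    using assms \<open>C \<noteq> {}\<close>
    by (intro convex_on_sum[OF _ _ exp_convex]) (auto simp: sum_divide_distrib[symmetric])
  also have "\<dots> = (\<Sum>c\<in>C. x c * a c) / d"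
    using assms by (simp add: sum_divide_distrib mult.commute)
  finally show ?thesis using assms(5) by (simp add: field_simps)
qed

text \<open>
  By the arithmetic-geometric mean inequality in every row, the capacity of a matrix with all row and
  column sums \<open>d\<close> is at least \<open>d ^ card R\<close>: the row sums normalise the weights, and the column sums
  make every variable appear in the product with total exponent \<open>1\<close>.
\<close>

theorem doubly_stochastic_lower_bound:
  fixes a :: "'c \<Rightarrow> 'a \<Rightarrow> real"
  assumes "finite R" "distinct cs" "length cs = card R" "d > 0"
    and pos: "\<And>c i. i \<in> R \<Longrightarrow> a c i > 0"
    and rows: "\<And>i. i \<in> R \<Longrightarrow> (\<Sum>c\<in>set cs. a c i) = d"
    and cols: "\<And>c. c \<in> set cs \<Longrightarrow> (\<Sum>i\<in>R. a c i) = d"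
  shows "(d / exp 1) ^ card R \<le> mixed_derivative (map a cs) R (\<lambda>_. 1)"
proof -
  have "d ^ card R * (\<Prod>c\<in>set cs. x c) \<le> (\<Prod>i\<in>R. 1 + (\<Sum>c\<in>set cs. x c * a c i))"
    if x: "\<And>c. x c > 0" for x
  proof -
    have "(\<Prod>c\<in>set cs. x c) = exp (\<Sum>c\<in>set cs. ln (x c))"
      by (simp add: exp_sum x)
    also have "(\<Sum>c\<in>set cs. ln (x c)) = (\<Sum>c\<in>set cs. (\<Sum>i\<in>R. a c i) / d * ln (x c))"
      using cols \<open>d > 0\<close> by (intro sum.cong) auto
    also have "\<dots> = (\<Sum>i\<in>R. \<Sum>c\<in>set cs. a c i / d * ln (x c))"
      by (subst sum.swap) (simp add: sum_divide_distrib sum_distrib_right)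
    finally have "d ^ card R * (\<Prod>c\<in>set cs. x c) =
        (\<Prod>i\<in>R. d * exp (\<Sum>c\<in>set cs. a c i / d * ln (x c)))"
      using assms(1) by (simp add: exp_sum prod.distrib)
    also have "\<dots> \<le> (\<Prod>i\<in>R. 1 + (\<Sum>c\<in>set cs. x c * a c i))"
    proof (intro prod_mono conjI)
      fix i assume i: "i \<in> R"
      have "d * exp (\<Sum>c\<in>set cs. a c i / d * ln (x c)) \<le> (\<Sum>c\<in>set cs. x c * a c i)"
        using pos[OF i] rows[OF i] \<open>d > 0\<close> x by (intro weighted_amgm) (auto simp: less_imp_le)
      then show "d * exp (\<Sum>c\<in>set cs. a c i / d * ln (x c)) \<le> 1 + (\<Sum>c\<in>set cs. x c * a c i)"
        by simp
    qed (use \<open>d > 0\<close> in auto)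
    finally show ?thesis .
  qed
  then have "d ^ card R / exp 1 ^ length (rev cs) \<le>
      mixed_derivative (map a (rev (rev cs) @ [])) R (\<lambda>_. 1)"
    using assms by (intro capacity_le_mixed_derivative) auto
  then show ?thesis using assms(3) by (simp add: power_divide)
qed

text \<open>
  Needed to pass from positive matrices, where stability applies, to the 0-1 matrix of a graph.
\<close>

lemma tendsto_mixed_derivative:
  fixes a :: "real \<Rightarrow> 'c \<Rightarrow> 'a \<Rightarrow> real"
  assumes "\<And>c i. ((\<lambda>e. a e c i) \<longlongrightarrow> a0 c i) F"
  shows "((\<lambda>e. mixed_derivative (map (a e) cs) R w) \<longlongrightarrow> mixed_derivative (map a0 cs) R w) F"
  by (induction cs arbitrary: R) (auto intro!: tendsto_intros assms)

lemma mixed_derivative_card_matchings: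
  assumes "finite C" "distinct cs" "length cs = card C"
  shows "mixed_derivative (map (\<lambda>c i. if i \<in> N c then 1 else 0) cs) C (\<lambda>_. 1) =
    real (card (matchings N (set cs) C))"
  using assms
proof (induction cs arbitrary: C)
  case Nil
  then have "matchings N (set []) C = {\<lambda>_. undefined}" by (auto simp: matchings_def bij_betw_def)
  then show ?case using Nil by simp
next
  case (Cons c cs)
  have "mixed_derivative (map (\<lambda>c i. if i \<in> N c then 1 else 0) (c # cs)) C (\<lambda>_. 1) =
      (\<Sum>i\<in>C. if i \<in> N c then real (card (matchings N (set cs) (C - {i}))) else 0)"
    using Cons by (auto intro!: sum.cong)
  also have "\<dots> = (\<Sum>i\<in>C \<inter> N c. real (card (matchings N (set cs) (C - {i}))))"
    using Cons.prems by (simp add: sum.inter_restrict)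
  also have "\<dots> = real (card (matchings N (set (c # cs)) C))"
    using Cons.prems by (subst card_matchings_expand[of _ _ c]) auto
  finally show ?case .
qed

theorem regular_matchings_lower_bound:
  assumes "finite D" "finite C" "card D = card C"
    and rows: "\<And>x. x \<in> D \<Longrightarrow> card (C \<inter> N x) = d"
    and cols: "\<And>k. k \<in> C \<Longrightarrow> card {x \<in> D. k \<in> N x} = d"
  shows "(d / exp 1) ^ card C \<le> card (matchings N D C)"
proof -
  obtain cs where cs: "set cs = D" "distinct cs" using finite_distinct_list[OF assms(1)] by blast
  have len: "length cs = card C" using cs assms(3) by (metis distinct_card)
  define n where "n = card C"
  define a where "a = (\<lambda>(e::real) x k. (if k \<in> N x then 1 else 0) + e)"
  have bound: "(d / exp 1) ^ n \<le> mixed_derivative (map (a e) cs) C (\<lambda>_. 1)" if "e > 0" for e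
  proof (cases "n = 0")
    case True
    then show ?thesis using assms(2) len by (simp add: n_def)
  next
    case False
    \<comment> \<open>Adding \<open>e\<close> to every entry keeps all row and column sums equal.\<close>
    have "(d / exp 1) ^ n \<le> ((d + n * e) / exp 1) ^ n"
      using that by (intro power_mono divide_right_mono) auto
    also have "\<dots> \<le> mixed_derivative (map (a e) cs) C (\<lambda>_. 1)"
      unfolding n_def
    proof (rule doubly_stochastic_lower_bound)
      show "(\<Sum>x\<in>set cs. a e x k) = d + card C * e" if "k \<in> C" for k
        using cols[OF that] assms(1,3) cs
        by (simp add: a_def sum.distrib sum.If_cases Int_def)
      show "(\<Sum>k\<in>C. a e x k) = d + card C * e" if "x \<in> set cs" for x
        using rows[of x] that assms(2) cs
        by (simp add: a_def sum.distrib sum.If_cases Int_def)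
      show "0 < d + card C * e" using that False by (simp add: n_def add_nonneg_pos)
    qed (use assms(2) cs len that in \<open>auto simp: a_def\<close>)
    finally show ?thesis .
  qed
  have "((\<lambda>e. mixed_derivative (map (a e) cs) C (\<lambda>_. 1)) \<longlongrightarrow>
      mixed_derivative (map (\<lambda>x k. if k \<in> N x then 1 else 0) cs) C (\<lambda>_. 1)) (at_right 0)"
    by (rule tendsto_mixed_derivative) (auto simp: a_def intro!: tendsto_eq_intros)
  moreover have "eventually (\<lambda>e. (d / exp 1) ^ n \<le> mixed_derivative (map (a e) cs) C (\<lambda>_. 1)) (at_right 0)"
    using bound by (auto simp: eventually_at_right_field intro: exI[of _ 1])
  ultimately have "(d / exp 1) ^ n \<le>
      mixed_derivative (map (\<lambda>x k. if k \<in> N x then 1 else 0) cs) C (\<lambda>_. 1)"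
    by (rule tendsto_lowerbound) simp
  then show ?thesis
    using mixed_derivative_card_matchings[OF assms(2) cs(2) len, of N] cs(1) by (simp add: n_def)
qed

section \<open>Counting Latin rectangles row by row\<close>

text \<open>
  Rectangles are curried, with rows \<open>Q\<close>, so that adding a row is a function update.
\<close>

definition latin_rectangles :: "'q set \<Rightarrow> 'c set \<Rightarrow> 's set \<Rightarrow> ('q \<Rightarrow> 'c \<Rightarrow> 's) set" where
  "latin_rectangles Q C S = {f \<in> Q \<rightarrow>\<^sub>E (C \<rightarrow>\<^sub>E S). (\<forall>i\<in>Q. bij_betw (f i) C S) \<and>
     (\<forall>i\<in>Q. \<forall>j\<in>Q. i \<noteq> j \<longrightarrow> (\<forall>c\<in>C. f i c \<noteq> f j c))}"

lemma finite_latin_rectangles: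
  assumes "finite Q" "finite C" "finite S"
  shows "finite (latin_rectangles Q C S)"
  unfolding latin_rectangles_def
  by (rule finite_subset[OF _ finite_PiE[of Q "\<lambda>_. C \<rightarrow>\<^sub>E S"]]) (use assms in \<open>auto intro: finite_PiE\<close>)

lemma restrict_latin_rectangle:
  assumes "g \<in> latin_rectangles Q C S" "P \<subseteq> Q"
  shows "restrict g P \<in> latin_rectangles P C S"
  using assms by (auto simp: latin_rectangles_def PiE_iff subset_iff)

lemma latin_rectangle_upd:
  assumes f: "f \<in> latin_rectangles Q C S" and "i \<notin> Q"
    and r: "r \<in> matchings (\<lambda>c. - (\<lambda>j. f j c) ` Q) C S"
  shows "f(i := r) \<in> latin_rectangles (insert i Q) C S"
  unfolding latin_rectangles_def
proof (intro CollectI conjI)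
  show "f(i := r) \<in> insert i Q \<rightarrow>\<^sub>E (C \<rightarrow>\<^sub>E S)"
    using f r by (intro PiE_fun_upd) (auto simp: latin_rectangles_def matchings_def)
  show "\<forall>j\<in>insert i Q. bij_betw ((f(i := r)) j) C S"
    using f r \<open>i \<notin> Q\<close> by (auto simp: latin_rectangles_def matchings_def)
  have new: "r c \<noteq> f j c" if "j \<in> Q" "c \<in> C" for j c
    using r that by (auto simp: matchings_def)
  have old: "f j c \<noteq> f k c" if "j \<in> Q" "k \<in> Q" "j \<noteq> k" "c \<in> C" for j k c
    using f that by (auto simp: latin_rectangles_def)
  show "\<forall>j\<in>insert i Q. \<forall>k\<in>insert i Q. j \<noteq> k \<longrightarrow>
      (\<forall>c\<in>C. (f(i := r)) j c \<noteq> (f(i := r)) k c)"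
    using new new[symmetric] old \<open>i \<notin> Q\<close> by (simp add: fun_upd_def)
qed

lemma card_row_extensions:
  assumes f: "f \<in> latin_rectangles Q C S" and i: "i \<notin> Q"
  shows "card {g \<in> latin_rectangles (insert i Q) C S. restrict g Q = f} =
    card (matchings (\<lambda>c. - (\<lambda>j. f j c) ` Q) C S)"
proof (rule bij_betw_same_card[OF bij_betw_byWitness[where f = "\<lambda>g. g i" and f' = "\<lambda>r. f(i := r)"]])
  show "\<forall>g\<in>{g \<in> latin_rectangles (insert i Q) C S. restrict g Q = f}. f(i := g i) = g"
  proof clarify
    fix g assume "g \<in> latin_rectangles (insert i Q) C S"
    then have "g \<in> extensional (insert i Q)" by (auto simp: latin_rectangles_def PiE_def)
    then show "(restrict g Q)(i := g i) = g" by (auto simp: extensional_def fun_eq_iff)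
  qed
  show "(\<lambda>g. g i) ` {g \<in> latin_rectangles (insert i Q) C S. restrict g Q = f}
      \<subseteq> matchings (\<lambda>c. - (\<lambda>j. f j c) ` Q) C S"
  proof clarify
    fix g assume g: "g \<in> latin_rectangles (insert i Q) C S" "f = restrict g Q"
    have "g i c \<noteq> g j c" if "j \<in> Q" "c \<in> C" for j c
    proof -
      have "i \<noteq> j" using i that by auto
      then show ?thesis using g(1) that by (simp add: latin_rectangles_def)
    qed
    then show "g i \<in> matchings (\<lambda>c. - (\<lambda>j. restrict g Q j c) ` Q) C S"
      using g(1) by (auto simp: matchings_def latin_rectangles_def)
  qed
  show "(\<lambda>r. f(i := r)) ` matchings (\<lambda>c. - (\<lambda>j. f j c) ` Q) C S
      \<subseteq> {g \<in> latin_rectangles (insert i Q) C S. restrict g Q = f}"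
  proof clarify
    fix r assume r: "r \<in> matchings (\<lambda>c. - (\<lambda>j. f j c) ` Q) C S"
    have "restrict (f(i := r)) Q = f"
      using f i by (auto simp: latin_rectangles_def PiE_iff extensional_def fun_eq_iff)
    then show "f(i := r) \<in> latin_rectangles (insert i Q) C S \<and> restrict (f(i := r)) Q = f"
      using latin_rectangle_upd[OF f i r] by simp
  qed
qed auto

text \<open>
  Both sides of the graph of possible next rows have the same degree: a column has already used one
  symbol per row, and a symbol has already been used in one column per row, all of them distinct.
\<close>

lemma row_extension_graph_regular:
  assumes f: "f \<in> latin_rectangles Q C S" and fin: "finite Q" "finite C" "finite S"
  shows "c \<in> C \<Longrightarrow> card (S \<inter> - (\<lambda>j. f j c) ` Q) = card S - card Q"
    and "s \<in> S \<Longrightarrow> card {c \<in> C. s \<in> - (\<lambda>j. f j c) ` Q} = card C - card Q"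
proof -
  have bij: "bij_betw (f j) C S" if "j \<in> Q" for j
    using f that by (auto simp: latin_rectangles_def)
  have ne: "f j c \<noteq> f k c" if "j \<in> Q" "k \<in> Q" "j \<noteq> k" "c \<in> C" for j k c
    using f that by (auto simp: latin_rectangles_def)
  {
    assume c: "c \<in> C"
    have "inj_on (\<lambda>j. f j c) Q" using ne c by (auto intro!: inj_onI)
    then have "card ((\<lambda>j. f j c) ` Q) = card Q" by (rule card_image)
    moreover have "(\<lambda>j. f j c) ` Q \<subseteq> S" using bij c by (auto simp: bij_betw_def)
    ultimately show "card (S \<inter> - (\<lambda>j. f j c) ` Q) = card S - card Q"
      using fin by (simp add: Diff_eq[symmetric] card_Diff_subset)
  }
  {
    assume s: "s \<in> S"
    define place where "place = (\<lambda>j. inv_into C (f j) s)"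
    have place: "place j \<in> C" "f j (place j) = s" if "j \<in> Q" for j
      using bij[OF that] s unfolding place_def
      by (auto simp: bij_betw_def inv_into_into f_inv_into_f)
    have "inj_on place Q"
      by (rule inj_onI) (metis ne place)
    then have "card (place ` Q) = card Q" by (rule card_image)
    moreover have "place ` Q = {c \<in> C. s \<in> (\<lambda>j. f j c) ` Q}"
    proof safe
      fix c j assume "c \<in> C" "j \<in> Q"
      then have "place j = c" if "s = f j c"
        using that bij[of j] unfolding place_def by (auto simp: bij_betw_def inv_into_f_f)
      then show "c \<in> place ` Q" if "s = f j c" using that \<open>j \<in> Q\<close> by auto
    qed (use place in force)+
    moreover have "{c \<in> C. s \<in> - (\<lambda>j. f j c) ` Q} = C - {c \<in> C. s \<in> (\<lambda>j. f j c) ` Q}" by auto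
    ultimately show "card {c \<in> C. s \<in> - (\<lambda>j. f j c) ` Q} = card C - card Q"
      using fin by (simp add: card_Diff_subset)
  }
qed

text \<open>
  The geometric mean of \<open>1, ..., d\<close>: in a matching problem where all degrees are \<open>d\<close>, Bregman's bound
  allows this many choices per vertex.
\<close>

definition geometric_mean_fact :: "nat \<Rightarrow> real" where
  "geometric_mean_fact d = exp (ln (fact d) / d)"

lemma geometric_mean_fact_pos: "geometric_mean_fact d > 0"
  by (simp add: geometric_mean_fact_def)

lemma card_row_extensions_bounds:
  assumes f: "f \<in> latin_rectangles Q C S" and i: "i \<notin> Q"
    and fin: "finite Q" "finite C" "finite S" and n: "card C = n" "card S = n"
  defines "E \<equiv> {g \<in> latin_rectangles (insert i Q) C S. restrict g Q = f}"
  shows "card E \<le> geometric_mean_fact (n - card Q) ^ n"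
    and "(real (n - card Q) / exp 1) ^ n \<le> card E"
proof -
  let ?N = "\<lambda>c. - (\<lambda>j. f j c) ` Q"
  have E: "card E = card (matchings ?N C S)"
    unfolding E_def by (rule card_row_extensions[OF f i])
  note reg = row_extension_graph_regular[OF f fin, unfolded n]
  show "(real (n - card Q) / exp 1) ^ n \<le> card E"
    using regular_matchings_lower_bound[of C S ?N "n - card Q"] reg fin n E by simp
  show "card E \<le> geometric_mean_fact (n - card Q) ^ n"
  proof (cases "matchings ?N C S = {}")
    case True
    then show ?thesis using E geometric_mean_fact_pos[of "n - card Q"] by simp
  next
    case False
    then have pos: "real (card (matchings ?N C S)) > 0"
      using fin finite_matchings by (auto simp: card_gt_0_iff)
    have "ln (card (matchings ?N C S)) \<le>
        (\<Sum>c\<in>C. ln (fact (card (S \<inter> ?N c))) / card (S \<inter> ?N c))"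
      using bregman_minc[OF fin(2,3) False] by simp
    also have "\<dots> = (\<Sum>c\<in>C. ln (fact (n - card Q)) / (n - card Q))"
      using reg by (intro sum.cong) auto
    also have "\<dots> = n * (ln (fact (n - card Q)) / (n - card Q))" using n by simp
    finally have "exp (ln (card (matchings ?N C S))) \<le>
        exp (n * (ln (fact (n - card Q)) / (n - card Q)))" by simp
    also have "\<dots> = geometric_mean_fact (n - card Q) ^ n"
      unfolding geometric_mean_fact_def by (rule exp_of_nat_mult)
    finally show ?thesis using pos E by simp
  qed
qed

lemma card_extend_family_by_row:
  assumes X: "X \<subseteq> latin_rectangles Q C S" and i: "i \<notin> Q"
    and fin: "finite Q" "finite C" "finite S" and n: "card C = n" "card S = n"
  defines "E \<equiv> {g \<in> latin_rectangles (insert i Q) C S. restrict g Q \<in> X}"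
  shows "card E \<le> card X * geometric_mean_fact (n - card Q) ^ n"
    and "card X * (real (n - card Q) / exp 1) ^ n \<le> card E"
proof -
  define F where "F = (\<lambda>f. {g \<in> latin_rectangles (insert i Q) C S. restrict g Q = f})"
  have finX: "finite X" using X fin finite_latin_rectangles finite_subset by metis
  have "finite (F f)" for f
    unfolding F_def using finite_latin_rectangles[of "insert i Q" C S] fin by simp
  moreover have "E = (\<Union>f\<in>X. F f)" by (auto simp: E_def F_def)
  ultimately have "card E = (\<Sum>f\<in>X. card (F f))"
    using finX by (simp only:) (rule card_UN_disjoint, auto simp: F_def)
  then have E: "real (card E) = (\<Sum>f\<in>X. real (card (F f)))" by simp
  have F: "card (F f) \<le> geometric_mean_fact (n - card Q) ^ n"
    "(real (n - card Q) / exp 1) ^ n \<le> card (F f)" if "f \<in> X" for f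
    using card_row_extensions_bounds[OF _ i fin n, of f] that X unfolding F_def by auto
  show "card E \<le> card X * geometric_mean_fact (n - card Q) ^ n"
    unfolding E using F(1) by (intro sum_bounded_above) auto
  show "card X * (real (n - card Q) / exp 1) ^ n \<le> card E"
    unfolding E using F(2) by (intro sum_bounded_below) auto
qed

text \<open>
  The bounds are uniform in the rectangle being extended. Hence a constraint on the first
  rows, expressed by the family \<open>X\<close>, influences the count only through the size of \<open>X\<close>.
\<close>

lemma card_extend_family_by_rows:
  assumes X: "X \<subseteq> latin_rectangles Q C S" and Q': "finite Q'" "Q \<inter> Q' = {}"
    and fin: "finite Q" "finite C" "finite S" and n: "card C = n" "card S = n"
  defines "E \<equiv> \<lambda>Q'. {g \<in> latin_rectangles (Q \<union> Q') C S. restrict g Q \<in> X}"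
  shows "card (E Q') \<le> card X * (\<Prod>k<card Q'. geometric_mean_fact (n - card Q - k) ^ n) \<and>
    card X * (\<Prod>k<card Q'. (real (n - card Q - k) / exp 1) ^ n) \<le> card (E Q')"
  using Q'
proof (induction Q' rule: finite_induct)
  case empty
  have "restrict g Q = g" if "g \<in> latin_rectangles Q C S" for g
    using that by (auto simp: latin_rectangles_def fun_eq_iff PiE_iff extensional_def)
  then have "E {} = X" using X by (auto simp: E_def)
  then show ?case by simp
next
  case (insert i Q')
  have EQ': "E Q' \<subseteq> latin_rectangles (Q \<union> Q') C S" by (auto simp: E_def)
  have i: "i \<notin> Q \<union> Q'" and finQ': "finite (Q \<union> Q')" and disj: "Q \<inter> Q' = {}"
    using insert fin by auto
  have step: "E (insert i Q') =
      {g \<in> latin_rectangles (insert i (Q \<union> Q')) C S. restrict g (Q \<union> Q') \<in> E Q'}"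
    using restrict_latin_rectangle[of _ "insert i (Q \<union> Q')" C S "Q \<union> Q'"]
    by (auto simp: E_def Int_absorb1 Int_absorb2)
  have c: "n - card (Q \<union> Q') = n - card Q - card Q'"
    using insert fin disj by (simp add: card_Un_disjoint)
  note bounds = card_extend_family_by_row[OF EQ' i finQ' fin(2,3) n, folded step, unfolded c]
  note IH = insert.IH[OF disj]
  have "card (E (insert i Q')) \<le> card (E Q') * geometric_mean_fact (n - card Q - card Q') ^ n"
    by (rule bounds)
  also have "\<dots> \<le> card X * (\<Prod>k<card Q'. geometric_mean_fact (n - card Q - k) ^ n) *
      geometric_mean_fact (n - card Q - card Q') ^ n"
    using IH geometric_mean_fact_pos[THEN less_imp_le] by (intro mult_right_mono) auto
  finally have upper: "card (E (insert i Q')) \<le>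
      card X * (\<Prod>k<card (insert i Q'). geometric_mean_fact (n - card Q - k) ^ n)"
    using insert by (simp add: mult.assoc)
  have "card X * (\<Prod>k<card (insert i Q'). (real (n - card Q - k) / exp 1) ^ n) =
      card X * (\<Prod>k<card Q'. (real (n - card Q - k) / exp 1) ^ n) *
      (real (n - card Q - card Q') / exp 1) ^ n"
    using insert by (simp add: mult.assoc)
  also have "\<dots> \<le> card (E Q') * (real (n - card Q - card Q') / exp 1) ^ n"
    using IH by (intro mult_right_mono) auto
  also have "\<dots> \<le> card (E (insert i Q'))" by (rule bounds)
  finally show ?case using upper by simp
qed

lemma card_latin_rectangles_bounds:
  assumes fin: "finite Q" "finite C" "finite S" and n: "card C = n" "card S = n"
  shows "card (latin_rectangles Q C S) \<le> (\<Prod>k<card Q. geometric_mean_fact (n - k) ^ n)"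
    and "(\<Prod>k<card Q. (real (n - k) / exp 1) ^ n) \<le> card (latin_rectangles Q C S)"
proof -
  have "{\<lambda>_. undefined} \<subseteq> latin_rectangles {} C S" by (auto simp: latin_rectangles_def)
  note bounds = card_extend_family_by_rows[OF this, of Q n]
  have "restrict g {} = (\<lambda>_. undefined)" for g :: "'a \<Rightarrow> 'b \<Rightarrow> 'c" by auto
  then show "card (latin_rectangles Q C S) \<le> (\<Prod>k<card Q. geometric_mean_fact (n - k) ^ n)"
    and "(\<Prod>k<card Q. (real (n - k) / exp 1) ^ n) \<le> card (latin_rectangles Q C S)"
    using bounds assms by simp_all
qed

lemma latin_square_count_lower_bound:
  "(\<Prod>k<n. (real (n - k) / exp 1) ^ n) \<le> card (latin_squares n)"
proof -
  let ?I = "{1..n}"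
  define uncurry where "uncurry = (\<lambda>f::nat \<Rightarrow> nat \<Rightarrow> nat. restrict (\<lambda>(i, j). f i j) (?I \<times> ?I))"
  have app: "uncurry f (i, j) = f i j" if "i \<in> ?I" "j \<in> ?I" for f i j
    using that by (simp add: uncurry_def)
  have "inj_on uncurry (latin_rectangles ?I ?I ?I)"
  proof (rule inj_onI)
    fix f g assume fg: "f \<in> latin_rectangles ?I ?I ?I" "g \<in> latin_rectangles ?I ?I ?I"
      "uncurry f = uncurry g"
    have f: "f \<in> ?I \<rightarrow>\<^sub>E (?I \<rightarrow>\<^sub>E ?I)" and g: "g \<in> ?I \<rightarrow>\<^sub>E (?I \<rightarrow>\<^sub>E ?I)"
      using fg by (auto simp: latin_rectangles_def)
    show "f = g"
    proof (rule PiE_ext[OF f g])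
      fix i assume i: "i \<in> ?I"
      show "f i = g i"
        by (rule PiE_ext[OF PiE_mem[OF f i] PiE_mem[OF g i]]) (metis app fg(3) i)
    qed
  qed
  moreover have "uncurry ` latin_rectangles ?I ?I ?I \<subseteq> latin_squares n"
  proof clarify
    fix f assume f: "f \<in> latin_rectangles ?I ?I ?I"
    then have bij: "bij_betw (f i) ?I ?I" if "i \<in> ?I" for i
      using that by (auto simp: latin_rectangles_def)
    have ne: "f i c \<noteq> f j c" if "i \<in> ?I" "j \<in> ?I" "i \<noteq> j" "c \<in> ?I" for i j c
      using f that unfolding latin_rectangles_def by blast
    have val: "f i c \<in> ?I" if "i \<in> ?I" "c \<in> ?I" for i c
      using bij[OF that(1)] that(2) by (auto simp: bij_betw_def)
    have col: "bij_betw (\<lambda>i. f i c) ?I ?I" if "c \<in> ?I" for c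
    proof -
      have "inj_on (\<lambda>i. f i c) ?I" by (rule inj_onI) (metis ne that)
      moreover have "(\<lambda>i. f i c) ` ?I \<subseteq> ?I" using val that by blast
      ultimately show ?thesis by (simp add: bij_betw_def endo_inj_surj)
    qed
    have "uncurry f \<in> (?I \<times> ?I) \<rightarrow>\<^sub>E ?I"
      using val by (auto simp: uncurry_def split: prod.splits simp del: atLeastAtMost_iff)
    moreover have "latin_square ?I ?I ?I (uncurry f)"
      unfolding latin_square_def
    proof (intro conjI ballI)
      show "uncurry f (i, j) \<in> ?I" if "i \<in> ?I" "j \<in> ?I" for i j
        using val that by (simp add: app)
      show "\<exists>!j. j \<in> ?I \<and> uncurry f (i, j) = s" if "i \<in> ?I" "s \<in> ?I" for i s
        using bij_betw_inv_into_right[OF bij[OF that(1)] that(2)]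
          bij_betw_apply[OF bij_betw_inv_into[OF bij[OF that(1)]] that(2)]
          bij_betw_imp_inj_on[OF bij[OF that(1)]] app[OF that(1)]
        by (metis inj_onD)
      show "\<exists>!i. i \<in> ?I \<and> uncurry f (i, j) = s" if "j \<in> ?I" "s \<in> ?I" for j s
        using bij_betw_inv_into_right[OF col[OF that(1)] that(2)]
          bij_betw_apply[OF bij_betw_inv_into[OF col[OF that(1)]] that(2)]
          bij_betw_imp_inj_on[OF col[OF that(1)]] app[OF _ that(1)]
        by (metis (no_types, lifting) inj_onD)
    qed auto
    ultimately show "uncurry f \<in> latin_squares n" by (simp add: latin_squares_def)
  qed
  ultimately have "card (latin_rectangles ?I ?I ?I) \<le> card (latin_squares n)"
    by (rule card_inj_on_le) (rule finite_latin_squares)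
  then show ?thesis
    using card_latin_rectangles_bounds(2)[of ?I ?I ?I n] by simp
qed

text \<open>
  If the rows in \<open>R\<close> map \<open>C\<close> into \<open>S\<close>, then, as \<open>C\<close> and \<open>S\<close> have the same size, each of them also maps
  the complement of \<open>C\<close> onto that of \<open>S\<close>, and the rectangle splits into two independent ones.
\<close>

lemma card_block_rectangles:
  assumes fin: "finite R" "finite T" "finite V" and "C \<subseteq> T" "S \<subseteq> V" "card C = card S"
  shows "card {f \<in> latin_rectangles R T V. \<forall>i\<in>R. \<forall>c\<in>C. f i c \<in> S} \<le>
    card (latin_rectangles R C S) * card (latin_rectangles R (T - C) (V - S))"
proof -
  let ?X = "{f \<in> latin_rectangles R T V. \<forall>i\<in>R. \<forall>c\<in>C. f i c \<in> S}"
  define part where "part = (\<lambda>(f::'a \<Rightarrow> 'b \<Rightarrow> 'c) D. restrict (\<lambda>i. restrict (f i) D) R)"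
  have app: "part f D i c = f i c" if "i \<in> R" "c \<in> D" for f D i c
    using that by (simp add: part_def)
  have finC: "finite C" "finite S" using assms finite_subset by blast+
  have "inj_on (\<lambda>f. (part f C, part f (T - C))) ?X"
  proof (rule inj_onI)
    fix f g assume fg: "f \<in> ?X" "g \<in> ?X"
      and eq: "(part f C, part f (T - C)) = (part g C, part g (T - C))"
    have f: "f \<in> R \<rightarrow>\<^sub>E (T \<rightarrow>\<^sub>E V)" and g: "g \<in> R \<rightarrow>\<^sub>E (T \<rightarrow>\<^sub>E V)"
      using fg by (auto simp: latin_rectangles_def)
    show "f = g"
    proof (rule PiE_ext[OF f g])
      fix i assume i: "i \<in> R"
      show "f i = g i"
      proof (rule PiE_ext[OF PiE_mem[OF f i] PiE_mem[OF g i]])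
        fix c assume "c \<in> T"
        then show "f i c = g i c" using eq app[OF i] by (metis Diff_iff Pair_inject)
      qed
    qed
  qed
  moreover have "(\<lambda>f. (part f C, part f (T - C))) ` ?X \<subseteq>
      latin_rectangles R C S \<times> latin_rectangles R (T - C) (V - S)"
  proof clarify
    fix f assume f: "f \<in> latin_rectangles R T V" and block: "\<forall>i\<in>R. \<forall>c\<in>C. f i c \<in> S"
    have bij: "bij_betw (f i) T V" if "i \<in> R" for i
      using f that by (auto simp: latin_rectangles_def)
    have ne: "f i c \<noteq> f j c" if "i \<in> R" "j \<in> R" "i \<noteq> j" "c \<in> T" for i j c
      using f that unfolding latin_rectangles_def by blast
    have bij1: "bij_betw (f i) C S" if i: "i \<in> R" for i
    proof -
      have inj: "inj_on (f i) C"
        using bij[OF i] \<open>C \<subseteq> T\<close> by (meson bij_betw_def inj_on_subset)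
      moreover have "f i ` C = S"
        using inj block i finC \<open>card C = card S\<close> by (intro card_subset_eq) (auto simp: card_image)
      ultimately show ?thesis by (simp add: bij_betw_def)
    qed
    have bij2: "bij_betw (f i) (T - C) (V - S)" if i: "i \<in> R" for i
      using bij[OF i] bij1[OF i] \<open>C \<subseteq> T\<close>
      by (metis bij_betw_def inj_on_image_set_diff inj_on_subset Diff_subset subset_refl)
    have part: "part f D \<in> latin_rectangles R D V'" if "D \<subseteq> T" "\<And>i. i \<in> R \<Longrightarrow> bij_betw (f i) D V'" for D V'
    proof -
      have "bij_betw (part f D i) D V'" if "i \<in> R" for i
        using \<open>\<And>i. i \<in> R \<Longrightarrow> bij_betw (f i) D V'\<close>[OF that]
        by (rule bij_betw_cong[THEN iffD1, rotated]) (simp add: app that)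
      moreover have "part f D i \<in> D \<rightarrow>\<^sub>E V'" if "i \<in> R" for i
        using \<open>\<And>i. i \<in> R \<Longrightarrow> bij_betw (f i) D V'\<close>[OF that] that
        by (auto simp: part_def bij_betw_def)
      moreover have "part f D \<in> extensional R" by (simp add: part_def)
      moreover have "part f D i c \<noteq> part f D j c" if "i \<in> R" "j \<in> R" "i \<noteq> j" "c \<in> D" for i j c
        using ne[of i j c] that \<open>D \<subseteq> T\<close> by (auto simp: app)
      ultimately show ?thesis by (auto simp: latin_rectangles_def PiE_def)
    qed
    show "part f C \<in> latin_rectangles R C S \<and> part f (T - C) \<in> latin_rectangles R (T - C) (V - S)"
      using part[of C S] part[of "T - C" "V - S"] bij1 bij2 \<open>C \<subseteq> T\<close> by auto
  qed
  ultimately have "card ?X \<le> card (latin_rectangles R C S \<times> latin_rectangles R (T - C) (V - S))"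
    by (rule card_inj_on_le) (use fin finC in \<open>auto intro!: finite_cartesian_product finite_latin_rectangles\<close>)
  then show ?thesis by (simp add: card_cartesian_product)
qed

text \<open>
  The rows of the subsquare are filled first, as two separate rectangles; the other \<open>n - m\<close> rows
  are then bounded as in an arbitrary Latin square.
\<close>

lemma card_latin_squares_with_subsquare:
  assumes "R \<subseteq> {1..n}" "C \<subseteq> {1..n}" "S \<subseteq> {1..n}" "card R = m" "card C = m" "card S = m"
  shows "card {L \<in> latin_squares n. latin_square R C S L} \<le>
    (\<Prod>k<m. geometric_mean_fact (m - k) ^ m * geometric_mean_fact (n - m - k) ^ (n - m)) *
    (\<Prod>k<n - m. geometric_mean_fact (n - m - k) ^ n)"
proof -
  let ?I = "{1..n}"
  define X where "X = {f \<in> latin_rectangles R ?I ?I. \<forall>i\<in>R. \<forall>c\<in>C. f i c \<in> S}"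
  define E where "E = {g \<in> latin_rectangles (R \<union> (?I - R)) ?I ?I. restrict g R \<in> X}"
  define curried where
    "curried = (\<lambda>L::nat \<times> nat \<Rightarrow> nat. restrict (\<lambda>i. restrict (\<lambda>j. L (i, j)) ?I) ?I)"
  have fin: "finite R" "finite C" "finite S" using assms finite_subset by blast+
  have RI: "R \<union> (?I - R) = ?I" using assms by auto
  have "inj_on curried (latin_squares n)"
  proof (rule inj_onI)
    fix L L' assume L: "L \<in> latin_squares n" "L' \<in> latin_squares n" "curried L = curried L'"
    then have PiE: "L \<in> (?I \<times> ?I) \<rightarrow>\<^sub>E ?I" "L' \<in> (?I \<times> ?I) \<rightarrow>\<^sub>E ?I"
      by (simp_all add: latin_squares_def)
    have entry: "L (i, j) = L' (i, j)" if "i \<in> ?I" "j \<in> ?I" for i j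
      using L(3)[THEN fun_cong, of i, THEN fun_cong, of j] that by (simp add: curried_def)
    show "L = L'" by (rule PiE_ext[OF PiE]) (use entry in force)
  qed
  then have "inj_on curried {L \<in> latin_squares n. latin_square R C S L}"
    by (rule inj_on_subset) auto
  moreover have "curried ` {L \<in> latin_squares n. latin_square R C S L} \<subseteq> E"
  proof clarify
    fix L assume L: "L \<in> latin_squares n" and sub: "latin_square R C S L"
    have sq: "latin_square ?I ?I ?I L" using L by (simp add: latin_squares_def)
    have app: "curried L i j = L (i, j)" if "i \<in> ?I" "j \<in> ?I" for i j
      using that by (simp add: curried_def)
    have val: "L (i, j) \<in> ?I" if "i \<in> ?I" "j \<in> ?I" for i j
      using sq that unfolding latin_square_def by blast
    have row: "bij_betw (curried L i) ?I ?I" if i: "i \<in> ?I" for i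
      unfolding bij_betw_def
    proof
      have "j = k" if "j \<in> ?I" "k \<in> ?I" "L (i, j) = L (i, k)" for j k
        using sq that i val[OF i that(1)] unfolding latin_square_def by blast
      then show inj: "inj_on (curried L i) ?I" using app[OF i] by (auto intro!: inj_onI simp del: atLeastAtMost_iff)
      have "curried L i ` ?I \<subseteq> ?I" using app[OF i] val[OF i] by auto
      then show "curried L i ` ?I = ?I" using inj by (intro endo_inj_surj) auto
    qed
    have col: "curried L i c \<noteq> curried L j c" if "i \<in> ?I" "j \<in> ?I" "i \<noteq> j" "c \<in> ?I" for i j c
      unfolding app[OF that(1,4)] app[OF that(2,4)]
      using sq that val[OF that(1,4)] unfolding latin_square_def by blast
    have "curried L \<in> ?I \<rightarrow>\<^sub>E (?I \<rightarrow>\<^sub>E ?I)"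
      using val by (auto simp: curried_def simp del: atLeastAtMost_iff)
    then have rect: "curried L \<in> latin_rectangles ?I ?I ?I"
      using row col unfolding latin_rectangles_def by blast
    moreover have "restrict (curried L) R \<in> X"
    proof -
      have "curried L i c \<in> S" if "i \<in> R" "c \<in> C" for i c
      proof -
        have "i \<in> ?I" "c \<in> ?I" using that assms(1,2) by auto
        then show ?thesis using sub that app[of i c] by (simp add: latin_square_def)
      qed
      then show ?thesis
        using restrict_latin_rectangle[OF rect assms(1)] by (simp add: X_def)
    qed
    ultimately show "curried L \<in> E" unfolding E_def RI by simp
  qed
  moreover have "finite E"
    unfolding E_def RI using finite_latin_rectangles[of ?I ?I ?I] by simp
  ultimately have "card {L \<in> latin_squares n. latin_square R C S L} \<le> card E"
    by (rule card_inj_on_le)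
  then have "real (card {L \<in> latin_squares n. latin_square R C S L}) \<le> card E" by simp
  also have "\<dots> \<le> card X * (\<Prod>k<n - m. geometric_mean_fact (n - m - k) ^ n)"
    using card_extend_family_by_rows[of X R ?I ?I "?I - R" n] assms fin
    unfolding E_def by (auto simp: X_def card_Diff_subset)
  also have "card X \<le> card (latin_rectangles R C S) * card (latin_rectangles R (?I - C) (?I - S))"
    unfolding X_def using assms fin by (intro card_block_rectangles) auto
  then have "real (card X) \<le> real (card (latin_rectangles R C S)) *
      real (card (latin_rectangles R (?I - C) (?I - S)))"
    by (metis of_nat_le_iff of_nat_mult)
  also have "\<dots> \<le> (\<Prod>k<m. geometric_mean_fact (m - k) ^ m) *
      (\<Prod>k<m. geometric_mean_fact (n - m - k) ^ (n - m))"
    using card_latin_rectangles_bounds(1)[of R C S m]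
      card_latin_rectangles_bounds(1)[of R "?I - C" "?I - S" "n - m"] assms fin
    by (intro mult_mono) (auto simp: card_Diff_subset prod_nonneg geometric_mean_fact_pos less_imp_le)
  also have "\<dots> = (\<Prod>k<m. geometric_mean_fact (m - k) ^ m * geometric_mean_fact (n - m - k) ^ (n - m))"
    by (simp add: prod.distrib)
  finally show ?thesis
    by (simp add: prod_nonneg geometric_mean_fact_pos less_imp_le mult_right_mono)
qed

text \<open>
  In the columns \<open>C\<close>, a row outside the subsquare must avoid the symbols \<open>S\<close>, since these already
  occur there in the rows \<open>R\<close>; so it contains \<open>m\<close> distinct symbols from a set of size \<open>n - m\<close>.
\<close>

lemma proper_subsquare_le_half:
  assumes L: "L \<in> latin_squares n" and sub: "latin_square R C S L"
    and R: "R \<subseteq> {1..n}" "C \<subseteq> {1..n}" "card R = m" "m < n"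
  shows "2 * m \<le> n" and "m > 0 \<Longrightarrow> S \<subseteq> {1..n}"
proof -
  let ?I = "{1..n}"
  have sq: "latin_square ?I ?I ?I L" using L by (simp add: latin_squares_def)
  have val: "L (i, j) \<in> ?I" if "i \<in> ?I" "j \<in> ?I" for i j
    using sq that unfolding latin_square_def by blast
  have S: "finite S" "card S = m" "card C = m" using sub R by (auto simp: latin_square_def)
  show SI: "S \<subseteq> ?I" if "m > 0"
  proof
    fix s assume s: "s \<in> S"
    have "R \<noteq> {}" using that R(3) by auto
    then obtain i where "i \<in> R" by blast
    then obtain j where "j \<in> C" "L (i, j) = s" using sub s unfolding latin_square_def by blast
    then show "s \<in> ?I" using val[of i j] \<open>i \<in> R\<close> R by blast
  qed
  obtain r where r: "r \<in> ?I" "r \<notin> R"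
    using R by (metis card_atLeastAtMost card_mono diff_Suc_1 finite_subset finite_atLeastAtMost not_le subsetI)
  have "inj_on (\<lambda>c. L (r, c)) C"
  proof (rule inj_onI)
    fix c d assume cd: "c \<in> C" "d \<in> C" "L (r, c) = L (r, d)"
    then have "c \<in> ?I" "d \<in> ?I" using R by auto
    then show "c = d" using sq r(1) cd(3) val[of r c] unfolding latin_square_def by blast
  qed
  moreover have "(\<lambda>c. L (r, c)) ` C \<subseteq> ?I - S"
  proof clarify
    fix c assume c: "c \<in> C"
    then have cI: "c \<in> ?I" using R by auto
    have "L (r, c) \<notin> S"
    proof
      assume "L (r, c) \<in> S"
      then obtain i where i: "i \<in> R" "L (i, c) = L (r, c)"
        using sub c unfolding latin_square_def by metis
      then have "i \<in> ?I" using R by auto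
      then have "i = r" using sq i(2) r(1) cI val[of r c] unfolding latin_square_def by blast
      then show False using i r by simp
    qed
    then show "L (r, c) \<in> ?I - S" using val[OF r(1) cI] by simp
  qed
  ultimately have "card C \<le> card (?I - S)" by (rule card_inj_on_le) simp
  then show "2 * m \<le> n"
    using S SI by (cases "m = 0") (simp_all add: card_Diff_subset)
qed

section \<open>Comparison of the two counts\<close>

lemma ln_Suc_diff_ge: "d > 0 \<Longrightarrow> ln (real (Suc d)) - ln (real d) \<ge> 1 / real (Suc d)"
  using ln_le_minus_one[of "real d / real (Suc d)"] by (simp add: ln_div field_simps)

lemma ln_fact_le:
  assumes "d > 0"
  shows "ln (fact d) \<le> 1 + ln (real d) + real d * (ln (real d) - 1)"
  using assms
proof (induction d rule: nat_induct_non_zero)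
  case (Suc d)
  have "ln (fact (Suc d) :: real) = ln (real (Suc d)) + ln (fact d)"
    by (simp only: fact_Suc) (subst ln_mult, auto)
  also have "\<dots> \<le> ln (real (Suc d)) + (1 + ln (real d) + real d * (ln (real d) - 1))"
    using Suc by simp
  also have "\<dots> = 1 + ln (real (Suc d)) + real (Suc d) * ln (real d) - real d"
    by (simp add: algebra_simps)
  also have "\<dots> \<le> 1 + ln (real (Suc d)) + real (Suc d) * (ln (real (Suc d)) - 1 / real (Suc d)) - real d"
    using ln_Suc_diff_ge[OF Suc.hyps] by (intro diff_right_mono add_left_mono mult_left_mono) auto
  also have "\<dots> = 1 + ln (real (Suc d)) + real (Suc d) * (ln (real (Suc d)) - 1)"
    by (simp add: field_simps)
  finally show ?case .
qed simp

text \<open>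
  The loss per entry between Bregman's bound and the lower bound \<open>d / e\<close>. The uniform numerator \<open>1 + ln n\<close>
  leaves a harmonic sum when the losses of all rows are added.
\<close>

lemma ln_geometric_mean_fact_le:
  assumes "d > 0" "d \<le> n"
  shows "ln (geometric_mean_fact d) \<le> ln (real d) - 1 + (1 + ln (real n)) / real d"
proof -
  have "ln (geometric_mean_fact d) = ln (fact d) / real d"
    by (simp add: geometric_mean_fact_def)
  also have "\<dots> \<le> (1 + ln (real d) + real d * (ln (real d) - 1)) / real d"
    using ln_fact_le[OF assms(1)] by (intro divide_right_mono) auto
  also have "\<dots> = ln (real d) - 1 + (1 + ln (real d)) / real d"
    using assms by (simp add: field_simps)
  also have "\<dots> \<le> ln (real d) - 1 + (1 + ln (real n)) / real d"
    using assms by (intro add_left_mono divide_right_mono) auto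
  finally show ?thesis .
qed

lemma harmonic_sum_le: "(\<Sum>k<j. 1 / real (j - k)) \<le> 1 + ln (real j)"
proof (induction j)
  case (Suc j)
  have "(\<Sum>k<Suc j. 1 / real (Suc j - k)) = 1 / real (Suc j) + (\<Sum>k<j. 1 / real (j - k))"
    by (subst sum.lessThan_Suc_shift) simp
  then show ?case
    using Suc ln_Suc_diff_ge[of j] by (cases "j = 0") auto
qed simp

text \<open>
  The gain from one row of the subsquare. The \<open>n - m\<close> columns outside \<open>C\<close> do not increase the count,
  and each of the \<open>m\<close> columns in \<open>C\<close> gains a factor \<open>(m - k) / (n - k) \<le> m / n\<close>.
\<close>

lemma block_row_le:
  assumes "k < m" "2 * m \<le> n"
  shows "m * ln (real (m - k)) + (real n - m) * ln (real (n - m - k)) - n * ln (real (n - k))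
    \<le> - (m * ln (n / m))"
proof -
  have pos: "real (m - k) > 0" "real (n - m - k) > 0" "real (n - k) > 0" "real m > 0" "real n > 0"
    using assms by auto
  have "ln (real (n - m - k)) \<le> ln (real (n - k))" using pos assms by (subst ln_le_cancel_iff) auto
  then have 1: "(real n - m) * ln (real (n - m - k)) \<le> (real n - m) * ln (real (n - k))"
    using assms by (intro mult_left_mono) auto
  have "real (m - k) * n \<le> m * real (n - k)"
    using assms mult_left_mono[of "real m" "real n" "real k"] by (simp add: of_nat_diff algebra_simps)
  then have "real (m - k) / real (n - k) \<le> m / n" using pos by (simp add: field_simps)
  then have "ln (real (m - k) / real (n - k)) \<le> ln (m / n)" using pos by (subst ln_le_cancel_iff) auto
  then have "ln (real (m - k)) - ln (real (n - k)) \<le> - ln (n / m)"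
    using pos by (simp add: ln_div)
  then have "m * (ln (real (m - k)) - ln (real (n - k))) \<le> m * - ln (n / m)"
    by (intro mult_left_mono) auto
  then show ?thesis using 1 by (simp add: algebra_simps)
qed

text \<open>
  Taking logarithms row by row: the gain of the \<open>m\<close> rows of the subsquare is \<open>m * m * ln (n / m)\<close>, and the
  losses sum to at most \<open>n * (1 + ln n)\<^sup>2\<close> for these rows and again for the \<open>n - m\<close> others, one factor
  \<open>1 + ln n\<close> being the loss numerator and the other a harmonic sum.
\<close>

lemma subsquare_bound_ratio:
  assumes m: "m > 0" "2 * m \<le> n"
  shows "(\<Prod>k<m. geometric_mean_fact (m - k) ^ m * geometric_mean_fact (n - m - k) ^ (n - m)) *
      (\<Prod>k<n - m. geometric_mean_fact (n - m - k) ^ n)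
    \<le> (\<Prod>k<n. (real (n - k) / exp 1) ^ n) *
      exp (2 * real n * (1 + ln n)\<^sup>2 - (real m)\<^sup>2 * ln (n / m))" (is "?U \<le> ?L * exp ?x")
proof -
  define g where "g = (\<lambda>d. ln (geometric_mean_fact d))"
  define \<epsilon> where "\<epsilon> = 1 + ln (real n)"
  have n: "n > 0" "m \<le> n" using m by auto
  have \<epsilon>: "\<epsilon> \<ge> 0" using n by (simp add: \<epsilon>_def)
  note gpos = geometric_mean_fact_pos
  have g: "g d \<le> ln (real d) - 1 + \<epsilon> * (1 / real d)" if "d > 0" "d \<le> n" for d
    using ln_geometric_mean_fact_le[OF that] by (simp add: g_def \<epsilon>_def)
  have U: "?U > 0" using gpos by (intro mult_pos_pos prod_pos) auto
  have L: "?L > 0" by (intro prod_pos) auto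
  have lnU: "ln ?U = (\<Sum>k<m. m * g (m - k) + (real n - m) * g (n - m - k)) + (\<Sum>k<n - m. n * g (n - m - k))"
  proof -
    have "ln ?U = ln (\<Prod>k<m. geometric_mean_fact (m - k) ^ m * geometric_mean_fact (n - m - k) ^ (n - m)) +
        ln (\<Prod>k<n - m. geometric_mean_fact (n - m - k) ^ n)"
      using gpos by (intro ln_mult_pos prod_pos) auto
    also have "ln (\<Prod>k<n - m. geometric_mean_fact (n - m - k) ^ n) = (\<Sum>k<n - m. n * g (n - m - k))"
      using gpos[THEN less_imp_neq, THEN not_sym] by (subst ln_prod) (simp_all add: ln_realpow g_def)
    also have "ln (\<Prod>k<m. geometric_mean_fact (m - k) ^ m * geometric_mean_fact (n - m - k) ^ (n - m)) =
        (\<Sum>k<m. ln (geometric_mean_fact (m - k) ^ m * geometric_mean_fact (n - m - k) ^ (n - m)))"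
      using gpos[THEN less_imp_neq, THEN not_sym] by (intro ln_prod) simp_all
    also have "\<dots> = (\<Sum>k<m. m * g (m - k) + (real n - m) * g (n - m - k))"
      using gpos n by (intro sum.cong) (simp_all add: ln_mult_pos ln_realpow g_def of_nat_diff)
    finally show ?thesis .
  qed
  define h where "h = (\<lambda>k. real n * (ln (real (n - k)) - 1))"
  have "ln ?L = (\<Sum>k<n. h k)"
    unfolding h_def by (subst ln_prod) (auto simp: ln_realpow ln_div)
  also have "\<dots> = (\<Sum>k<m. h k) + (\<Sum>k<n - m. h (k + m))"
    using sum.atLeastLessThan_concat[of 0 m n h] sum.shift_bounds_nat_ivl[of h 0 m "n - m"] n
    by (simp add: lessThan_atLeast0)
  finally have lnL: "ln ?L = (\<Sum>k<m. h k) + (\<Sum>k<n - m. h (k + m))" .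
  have harm: "(\<Sum>k<j. 1 / real (j - k)) \<le> \<epsilon>" if "j \<le> n" for j
  proof (cases "j = 0")
    case True
    then show ?thesis using \<epsilon> by simp
  next
    case False
    have "ln (real j) \<le> ln (real n)" using that False by simp
    then show ?thesis using harmonic_sum_le[of j] by (simp add: \<epsilon>_def)
  qed
  have first: "(\<Sum>k<m. m * g (m - k) + (real n - m) * g (n - m - k)) \<le>
      (\<Sum>k<m. h k) - m\<^sup>2 * ln (n / m) + n * \<epsilon>\<^sup>2"
  proof -
    have "m * g (m - k) + (real n - m) * g (n - m - k) \<le>
        h k - m * ln (n / m) + n * (\<epsilon> * (1 / real (m - k)))" if k: "k < m" for k
    proof -
      define loss where "loss = \<epsilon> * (1 / real (m - k))"
      have "m * g (m - k) \<le> m * (ln (real (m - k)) - 1 + \<epsilon> * (1 / real (m - k)))"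
        using k n by (intro mult_left_mono g) auto
      then have "m * g (m - k) \<le> m * (ln (real (m - k)) - 1 + loss)" by (simp only: loss_def)
      moreover have "(real n - m) * g (n - m - k) \<le> (real n - m) * (ln (real (n - m - k)) - 1 + loss)"
      proof (intro mult_left_mono)
        \<comment> \<open>Since \<open>n - m \<ge> m\<close>, the losses of both parts of the row are covered by one harmonic sum.\<close>
        have "1 / real (n - m - k) \<le> 1 / real (m - k)"
          using k m by (intro divide_left_mono) auto
        then have "\<epsilon> * (1 / real (n - m - k)) \<le> \<epsilon> * (1 / real (m - k))"
          using \<epsilon> by (intro mult_left_mono)
        then show "g (n - m - k) \<le> ln (real (n - m - k)) - 1 + loss"
          unfolding loss_def using g[of "n - m - k"] k m by auto
      qed (use n in auto)
      ultimately show ?thesis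
        unfolding loss_def[symmetric] h_def using block_row_le[OF k m(2)] by (simp add: algebra_simps)
    qed
    then have "(\<Sum>k<m. m * g (m - k) + (real n - m) * g (n - m - k)) \<le>
        (\<Sum>k<m. h k - m * ln (n / m) + n * (\<epsilon> * (1 / real (m - k))))"
      by (intro sum_mono) auto
    also have "\<dots> = (\<Sum>k<m. h k) - m\<^sup>2 * ln (n / m) + n * (\<epsilon> * (\<Sum>k<m. 1 / real (m - k)))"
      by (simp add: sum.distrib sum_subtractf sum_distrib_left power2_eq_square)
    also have "\<dots> \<le> (\<Sum>k<m. h k) - m\<^sup>2 * ln (n / m) + n * (\<epsilon> * \<epsilon>)"
      using harm[of m] n \<epsilon> by (intro add_left_mono mult_left_mono) auto
    finally show ?thesis by (simp add: power2_eq_square)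
  qed
  have second: "(\<Sum>k<n - m. n * g (n - m - k)) \<le> (\<Sum>k<n - m. h (k + m)) + n * \<epsilon>\<^sup>2"
  proof -
    have "(\<Sum>k<n - m. n * g (n - m - k)) \<le> (\<Sum>k<n - m. h (k + m) + n * (\<epsilon> * (1 / real (n - m - k))))"
    proof (intro sum_mono)
      fix k assume k: "k \<in> {..<n - m}"
      have "n * g (n - m - k) \<le> n * (ln (real (n - m - k)) - 1 + \<epsilon> * (1 / real (n - m - k)))"
        using k by (intro mult_left_mono g) auto
      also have "n - m - k = n - (k + m)" by simp
      finally show "n * g (n - m - k) \<le> h (k + m) + n * (\<epsilon> * (1 / real (n - m - k)))"
        by (simp add: h_def algebra_simps)
    qed
    also have "\<dots> = (\<Sum>k<n - m. h (k + m)) + n * (\<epsilon> * (\<Sum>k<n - m. 1 / real (n - m - k)))"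
      by (simp add: sum.distrib sum_distrib_left)
    also have "\<dots> \<le> (\<Sum>k<n - m. h (k + m)) + n * (\<epsilon> * \<epsilon>)"
      using harm[of "n - m"] n \<epsilon> by (intro add_left_mono mult_left_mono) auto
    finally show ?thesis by (simp add: power2_eq_square)
  qed
  have "ln ?U \<le> ln ?L + ?x"
    using lnU lnL first second by (simp add: \<epsilon>_def)
  then have "exp (ln ?U) \<le> exp (ln ?L + ?x)" by simp
  then show ?thesis using U L by (simp only: exp_add exp_ln)
qed

lemma few_squares_with_given_subsquare:
  assumes "R \<subseteq> {1..n}" "C \<subseteq> {1..n}" "card R = m" "card C = m" "card S = m" "0 < m" "m < n"
  shows "card {L \<in> latin_squares n. latin_square R C S L} \<le>
    card (latin_squares n) * exp (2 * real n * (1 + ln n)\<^sup>2 - (real m)\<^sup>2 * ln (n / m))"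
proof (cases "{L \<in> latin_squares n. latin_square R C S L} = {}")
  case True
  then show ?thesis by (simp only: card.empty) simp
next
  case False
  then obtain L where L: "L \<in> latin_squares n" "latin_square R C S L" by blast
  have half: "2 * m \<le> n" and S: "S \<subseteq> {1..n}"
    using proper_subsquare_le_half[OF L assms(1,2,3,7)] assms(6) by auto
  have "real (card {L \<in> latin_squares n. latin_square R C S L}) \<le>
      (\<Prod>k<n. (real (n - k) / exp 1) ^ n) * exp (2 * real n * (1 + ln n)\<^sup>2 - (real m)\<^sup>2 * ln (n / m))"
    using card_latin_squares_with_subsquare[OF assms(1,2) S assms(3-5)]
      subsquare_bound_ratio[OF assms(6) half] by (rule order_trans)
  also have "\<dots> \<le> card (latin_squares n) * exp (2 * real n * (1 + ln n)\<^sup>2 - (real m)\<^sup>2 * ln (n / m))"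
    using latin_square_count_lower_bound[of n] by (intro mult_right_mono) auto
  finally show ?thesis .
qed

text \<open>
  The constant \<open>8\<close> gives \<open>m\<^sup>2 \<ge> 64 n ln n\<close>. When \<open>m\<^sup>2 \<le> n powr (3/2)\<close>, the logarithm is at least \<open>ln n / 4\<close>, which yields
  the factor 16. Otherwise \<open>ln (n / m) \<ge> ln 2\<close> is enough, because \<open>n powr (3/2)\<close> dominates.
\<close>

lemma exponent_large:
  "eventually (\<lambda>n. \<forall>m. 8 * sqrt (real n * ln (real n)) \<le> real m \<and> 2 * m \<le> n \<longrightarrow>
     (real m)\<^sup>2 * ln (n / m) \<ge> 16 * real n * (ln n)\<^sup>2) sequentially"
proof -
  have "eventually (\<lambda>n. real n powr (3/2) * (1/2) \<ge> 16 * real n * (ln (real n))\<^sup>2) sequentially"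
    by real_asymp
  moreover have "eventually (\<lambda>n::nat. n \<ge> 2) sequentially" by (rule eventually_ge_at_top)
  ultimately show ?thesis
  proof eventually_elim
    case (elim n)
    have ln_n: "ln (real n) > 0" using elim(2) by simp
    show ?case
    proof (intro allI impI, elim conjE)
      fix m assume m: "8 * sqrt (real n * ln (real n)) \<le> real m" "2 * m \<le> n"
      have "0 < 8 * sqrt (real n * ln (real n))" using ln_n elim(2) by simp
      then have mpos: "real m > 0" using m(1) by linarith
      have "(8 * sqrt (real n * ln (real n)))\<^sup>2 \<le> (real m)\<^sup>2"
        using m(1) ln_n by (intro power_mono) auto
      then have m2: "64 * (real n * ln (real n)) \<le> (real m)\<^sup>2"
        using ln_n by (simp add: power_mult_distrib)
      have half: "ln (n / m) \<ge> 1 / 2"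
      proof -
        have "ln 2 \<le> ln (real n / m)" using m(2) mpos by (subst ln_le_cancel_iff) (auto simp: field_simps)
        then show ?thesis using ln2_ge_two_thirds by linarith
      qed
      show "16 * real n * (ln (real n))\<^sup>2 \<le> (real m)\<^sup>2 * ln (n / m)"
      proof (cases "(real m)\<^sup>2 \<le> real n powr (3/2)")
        case True
        then have "ln ((real m)\<^sup>2) \<le> ln (real n powr (3/2))"
          using mpos elim(2) by (subst ln_le_cancel_iff) auto
        then have "2 * ln (real m) \<le> 3/2 * ln (real n)"
          using mpos elim(2) by (simp add: ln_realpow ln_powr)
        then have "ln (real n) / 4 \<le> ln (n / m)" using mpos elim(2) by (simp add: ln_div)
        then have "64 * (real n * ln (real n)) * (ln (real n) / 4) \<le> (real m)\<^sup>2 * ln (n / m)"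
          using m2 ln_n by (intro mult_mono) auto
        then show ?thesis by (simp add: power2_eq_square)
      next
        case False
        then have "real n powr (3/2) * (1/2) \<le> (real m)\<^sup>2 * ln (n / m)"
          using half by (intro mult_mono) auto
        then show ?thesis using elim(1) by linarith
      qed
    qed
  qed
qed

text \<open>
  Union bound over the triples \<open>(R, C, S)\<close>. Once \<open>ln n \<ge> 1\<close>, the loss \<open>2 n (1 + ln n)\<^sup>2\<close> is at most \<open>8 n (ln n)\<^sup>2\<close>, so an
  exponent \<open>- 8 n (ln n)\<^sup>2 \<le> - 4 n\<close> remains, against at most \<open>8 ^ n \<le> exp (3 n)\<close> triples.
\<close>

lemma bad_latin_squares_rare:
  defines "bad \<equiv> \<lambda>n. {L \<in> latin_squares n. \<exists>m. 8 * sqrt (real n * ln (real n)) \<le> real m \<and> m < n \<and>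
     has_latin_subsquare n m L}"
  shows "eventually (\<lambda>n. real (card (bad n)) \<le> card (latin_squares n) * exp (- real n)) sequentially"
  using exponent_large eventually_ge_at_top[of "3::nat"]
proof eventually_elim
  case (elim n)
  define T where "T = {(R, C, S). R \<subseteq> {1..n} \<and> C \<subseteq> {1..n} \<and> S \<subseteq> {1..n} \<and>
    card C = card R \<and> card S = card R \<and> card R < n \<and> 2 * card R \<le> n \<and>
    8 * sqrt (real n * ln (real n)) \<le> real (card R)}"
  define A where "A = (\<lambda>(R, C, S). {L \<in> latin_squares n. latin_square R C S L})"
  have "exp 1 \<le> real n" using elim(2) exp_le by linarith
  then have ln_n: "ln (real n) \<ge> 1" using elim(2) by (subst ln_ge_iff) auto
  have pos: "m > 0" if "8 * sqrt (real n * ln (real n)) \<le> real m" for m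
  proof -
    have "0 < 8 * sqrt (real n * ln (real n))" using ln_n elim(2) by simp
    then show ?thesis using that by (cases m) auto
  qed
  have TPow: "T \<subseteq> Pow {1..n} \<times> Pow {1..n} \<times> Pow {1..n}" by (auto simp: T_def)
  then have finT: "finite T" by (rule finite_subset) simp
  have "card T \<le> card (Pow {1..n} \<times> Pow {1..n} \<times> Pow {1..n})"
    using TPow by (rule card_mono[rotated]) simp
  also have "\<dots> = 8 ^ n"
    by (simp add: card_cartesian_product card_Pow power_mult_distrib[symmetric])
  finally have "real (card T) \<le> 8 ^ n" by (metis of_nat_le_iff of_nat_numeral of_nat_power)
  also have "(8::real) ^ n \<le> exp 3 ^ n"
  proof (rule power_mono)
    have "(2::real) ^ 3 \<le> exp 1 ^ 3" by (intro power_mono) (use exp_ge_add_one_self[of 1] in auto)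
    then show "(8::real) \<le> exp 3" by (simp add: exp_of_nat_mult[symmetric])
  qed simp
  also have "exp 3 ^ n = exp (3 * real n)" by (simp add: exp_of_nat_mult[symmetric] mult.commute)
  finally have cardT: "real (card T) \<le> exp (3 * real n)" .
  have "bad n \<subseteq> (\<Union>t\<in>T. A t)"
  proof
    fix L assume "L \<in> bad n"
    then obtain m R C S where L: "L \<in> latin_squares n" and m: "8 * sqrt (real n * ln (real n)) \<le> real m" "m < n"
      and RCS: "R \<subseteq> {1..n}" "C \<subseteq> {1..n}" "card R = m" "card C = m" "card S = m" "latin_square R C S L"
      unfolding bad_def has_latin_subsquare_def by blast
    have "2 * m \<le> n" "S \<subseteq> {1..n}"
      using proper_subsquare_le_half[OF L RCS(6,1,2,3) m(2)] pos[OF m(1)] by auto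
    then have "(R, C, S) \<in> T" using m RCS by (simp add: T_def)
    moreover have "L \<in> A (R, C, S)" using L RCS by (simp add: A_def)
    ultimately show "L \<in> (\<Union>t\<in>T. A t)" by blast
  qed
  moreover have finA: "finite (A t)" for t
    by (rule finite_subset[OF _ finite_latin_squares[of n]]) (auto simp: A_def split: prod.splits)
  ultimately have "card (bad n) \<le> card (\<Union>t\<in>T. A t)"
    using finT by (intro card_mono) auto
  also have "\<dots> \<le> (\<Sum>t\<in>T. card (A t))" using finT by (rule card_UN_le)
  finally have "real (card (bad n)) \<le> (\<Sum>t\<in>T. real (card (A t)))"
    by (metis of_nat_le_iff of_nat_sum)
  also have "\<dots> \<le> (\<Sum>t\<in>T. card (latin_squares n) * exp (- 4 * real n))"
  proof (rule sum_mono)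
    fix t assume "t \<in> T"
    obtain R C S where t: "t = (R, C, S)" by (cases t)
    have RCS: "R \<subseteq> {1..n}" "C \<subseteq> {1..n}"
      "card C = card R" "card S = card R" "card R < n" "2 * card R \<le> n"
      "8 * sqrt (real n * ln (real n)) \<le> real (card R)"
      using \<open>t \<in> T\<close> by (simp_all add: T_def t)
    have exponent: "16 * real n * (ln n)\<^sup>2 \<le> (real (card R))\<^sup>2 * ln (n / card R)"
      using elim(1) RCS(6,7) by blast
    have "(1 + ln (real n))\<^sup>2 \<le> (2 * ln (real n))\<^sup>2"
      using ln_n by (intro power_mono) auto
    then have "2 * real n * (1 + ln n)\<^sup>2 \<le> 2 * real n * (2 * ln (real n))\<^sup>2"
      by (intro mult_left_mono) auto
    moreover have "real n * 1 \<le> real n * (ln (real n))\<^sup>2"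
      using ln_n by (intro mult_left_mono) (auto simp: one_le_power)
    ultimately have x: "2 * real n * (1 + ln n)\<^sup>2 - (real (card R))\<^sup>2 * ln (n / card R) \<le> - 4 * real n"
      using exponent by (simp add: power_mult_distrib)
    have "real (card (A t)) \<le> card (latin_squares n) *
        exp (2 * real n * (1 + ln n)\<^sup>2 - (real (card R))\<^sup>2 * ln (n / card R))"
      unfolding A_def t prod.case
      by (rule few_squares_with_given_subsquare) (use RCS pos in auto)
    also have "\<dots> \<le> card (latin_squares n) * exp (- 4 * real n)"
      using x by (intro mult_left_mono) auto
    finally show "real (card (A t)) \<le> card (latin_squares n) * exp (- 4 * real n)" .
  qed
  also have "\<dots> = real (card T) * (card (latin_squares n) * exp (- 4 * real n))" by simp
  also have "\<dots> \<le> exp (3 * real n) * (card (latin_squares n) * exp (- 4 * real n))"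
    using cardT by (intro mult_right_mono) auto
  also have "\<dots> = card (latin_squares n) * (exp (3 * real n) * exp (- 4 * real n))"
    by (simp only: mult_ac)
  also have "exp (3 * real n) * exp (- 4 * real n) = exp (- real n)"
    by (simp add: exp_add[symmetric])
  finally show ?case .
qed

theorem theorem1p2:
  shows "\<exists>c::real. c > 0 \<and>
    (\<lambda>n::nat. measure_pmf.prob (pmf_of_set (latin_squares n))
       {L. \<forall>m::nat. c * sqrt (real n * ln (real n)) \<le> real m \<and> m < n
             \<longrightarrow> \<not> has_latin_subsquare n m L}) \<longlonglongrightarrow> 1"
proof (intro exI[of _ 8] conjI)
  let ?good = "\<lambda>n. {L. \<forall>m::nat. 8 * sqrt (real n * ln (real n)) \<le> real m \<and> m < n
             \<longrightarrow> \<not> has_latin_subsquare n m L}"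
  let ?P = "\<lambda>n. measure_pmf.prob (pmf_of_set (latin_squares n)) (?good n)"
  have "eventually (\<lambda>n. 1 - exp (- real n) \<le> ?P n) sequentially"
    using bad_latin_squares_rare
  proof eventually_elim
    case (elim n)
    let ?bad = "{L \<in> latin_squares n. \<exists>m. 8 * sqrt (real n * ln (real n)) \<le> real m \<and> m < n \<and>
       has_latin_subsquare n m L}"
    have N: "real (card (latin_squares n)) > 0"
      using finite_latin_squares latin_squares_nonempty by (simp add: card_gt_0_iff)
    have "latin_squares n \<inter> ?good n = latin_squares n - ?bad" by blast
    moreover have "card (latin_squares n - ?bad) = card (latin_squares n) - card ?bad"
      by (rule card_Diff_subset) (auto intro: finite_subset[OF _ finite_latin_squares[of n]])
    moreover have "card ?bad \<le> card (latin_squares n)"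
      by (rule card_mono[OF finite_latin_squares]) auto
    ultimately have "real (card (latin_squares n \<inter> ?good n)) =
        real (card (latin_squares n)) - real (card ?bad)" by (simp only: of_nat_diff)
    then have "?P n = (real (card (latin_squares n)) - real (card ?bad)) / card (latin_squares n)"
      by (simp only: measure_pmf_of_set[OF latin_squares_nonempty finite_latin_squares])
    also have "\<dots> = 1 - card ?bad / card (latin_squares n)" using N by (simp add: diff_divide_distrib)
    finally have P: "?P n = 1 - card ?bad / card (latin_squares n)" .
    have "card ?bad / card (latin_squares n) \<le> exp (- real n)"
      using elim N by (simp only: pos_divide_le_eq mult.commute)
    then show ?case unfolding P by simp
  qed
  moreover have "eventually (\<lambda>n. ?P n \<le> 1) sequentially"
    by (simp add: measure_pmf.prob_le_1)
  moreover have "(\<lambda>n. 1 - exp (- real n)) \<longlonglongrightarrow> 1" by real_asymp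
  ultimately show "?P \<longlonglongrightarrow> 1"
    by (intro tendsto_sandwich[of "\<lambda>n. 1 - exp (- real n)" ?P sequentially "\<lambda>_. 1"]) auto
qed simp

end
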